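(* For every density matrix $\rho$ on $\mathcal{H}_d$ with $d\le3$, $C_a(\rho)=C_a^\infty(\rho)$. For every $d\ge4$ there exist density matrices $\rho$ on $\mathcal{H}_d$ such that $C_a^\infty(\rho)>C_a(\rho)$.
   Context: $\mathcal{H}_d$ is a complex Hilbert space of finite dimension $d$ with a fixed orthonormal (reference) basis $\{|i\rangle\}_{i=1}^d$; for tensor powers the reference basis is the product basis. $\Delta(X)=\sum_i|i\rangle\langle i|X|i\rangle\langle i|$ is the dephasing map in the reference basis, $S$ is the von Neumann entropy (base-2 logarithm), and $\psi:=|\psi\rangle\langle\psi|$ for a unit vector $|\psi\rangle$. The coherence of assistance of a density matrix $\rho$ is $$C_a(\rho):=\max\Big\{\sum_ip_iS(\Delta(\psi_i)):\rho=\sum_ip_i\psi_i\Big\},$$ the maximum being over all pure-state convex decompositions of $\rho$, and its regularization is $C_a^\infty(\rho):=\lim_{n\to\infty}\frac1nC_a(\rho^{\otimes n})$. (It is a known result that $C_a^\infty(\rho)=S(\Delta(\rho))$ for every density matrix $\rho$.) *)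

theory Defs
  imports Complex_Main "Jordan_Normal_Form.Char_Poly"
begin

text \<open>
  A Hilbert space of dimension \<open>d\<close> with a fixed orthonormal reference basis is identified with
  the space of complex vectors of length \<open>d\<close> and its standard basis (indexed by \<open>0, \<dots>, d - 1\<close>),
  operators with complex \<open>d \<times> d\<close> matrices.
\<close>

definition mat_trace :: "complex mat \<Rightarrow> complex" where
  "mat_trace A = (\<Sum>i<dim_row A. A $$ (i, i))"

text \<open>
  The order on \<open>complex\<close> is that of \<open>HOL-Library.Complex_Order\<close>: \<open>0 \<le> z\<close> means that \<open>z\<close> is real and
  nonnegative. As the quadratic form is required to be real on all complex vectors, positivity
  includes self-adjointness.
\<close>

definition density_matrix :: "nat \<Rightarrow> complex mat \<Rightarrow> bool" where
  "density_matrix d \<rho> \<longleftrightarrow>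
     \<rho> \<in> carrier_mat d d \<and>
     (\<forall>v\<in>carrier_vec d. 0 \<le> (\<rho> *\<^sub>v v) \<bullet>c v) \<and>
     mat_trace \<rho> = 1"

definition unit_vector :: "nat \<Rightarrow> complex vec \<Rightarrow> bool" where
  "unit_vector d v \<longleftrightarrow> v \<in> carrier_vec d \<and> v \<bullet>c v = 1"

text \<open>The projector \<open>|v><v|\<close>.\<close>

definition ket_bra :: "complex vec \<Rightarrow> complex mat" where
  "ket_bra v = mat (dim_vec v) (dim_vec v) (\<lambda>(i, j). v $ i * cnj (v $ j))"

text \<open>The entry \<open>(i, i)\<close> of \<open>X\<close> is \<open><i|X|i>\<close>, so this is \<open>\<Sum>\<^sub>i |i><i|X|i><i|\<close>.\<close>

definition dephase :: "complex mat \<Rightarrow> complex mat" where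
  "dephase X = mat_diag (dim_row X) (\<lambda>i. X $$ (i, i))"

text \<open>
  \<open>- Tr (\<rho> log\<^sub>2 \<rho>)\<close>: the eigenvalues of \<open>\<rho>\<close> with their multiplicities are the roots of the
  characteristic polynomial. The convention \<open>0 log 0 = 0\<close> holds because of the factor \<open>Re x\<close>.
\<close>

definition von_neumann_entropy :: "complex mat \<Rightarrow> real" where
  "von_neumann_entropy \<rho> = - (\<Sum>x\<in>#proots (char_poly \<rho>). Re x * log 2 (Re x))"

text \<open>
  The Kronecker product. Its basis is the product basis, with the pair \<open>(i, k)\<close> encoded as
  \<open>i * dim B + k\<close>; thus the reference basis of a tensor power is again the standard basis, and
  \<^const>\<open>dephase\<close> applies to tensor powers without change.
\<close>

definition kronecker :: "complex mat \<Rightarrow> complex mat \<Rightarrow> complex mat" where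
  "kronecker A B = mat (dim_row A * dim_row B) (dim_col A * dim_col B)
     (\<lambda>(i, j). A $$ (i div dim_row B, j div dim_col B) * B $$ (i mod dim_row B, j mod dim_col B))"

fun tensor_power :: "complex mat \<Rightarrow> nat \<Rightarrow> complex mat" where
  "tensor_power A 0 = 1\<^sub>m 1"
| "tensor_power A (Suc n) = kronecker A (tensor_power A n)"

definition pure_state_decomposition ::
  "complex mat \<Rightarrow> nat \<Rightarrow> (nat \<Rightarrow> real) \<Rightarrow> (nat \<Rightarrow> complex vec) \<Rightarrow> bool" where
  "pure_state_decomposition \<rho> m p \<psi> \<longleftrightarrow>
     (\<forall>i<m. 0 \<le> p i \<and> unit_vector (dim_row \<rho>) (\<psi> i)) \<and>
     (\<Sum>i<m. p i) = 1 \<and>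
     \<rho> = mat (dim_row \<rho>) (dim_row \<rho>)
           (\<lambda>(a, b). \<Sum>i<m. complex_of_real (p i) * ket_bra (\<psi> i) $$ (a, b))"

text \<open>
  For a density matrix the set below is nonempty, bounded above and has a maximum (by
  Caratheodory's theorem and compactness), so that the supremum is this maximum.
\<close>

definition coherence_of_assistance :: "complex mat \<Rightarrow> real" where
  "coherence_of_assistance \<rho> =
     Sup {(\<Sum>i<m. p i * von_neumann_entropy (dephase (ket_bra (\<psi> i)))) | m p \<psi>.
            pure_state_decomposition \<rho> m p \<psi>}"

definition regularized_coherence_of_assistance :: "complex mat \<Rightarrow> real" where
  "regularized_coherence_of_assistance \<rho> =
     lim (\<lambda>n. coherence_of_assistance (tensor_power \<rho> n) / real n)"

end

theory Submission
  imports Defs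
begin

text \<open>
  Write \<open>\<eta>(x) = - x log\<^sub>2 x\<close>. By concavity of \<open>\<eta>\<close>, \<open>C\<^sub>a(\<rho>) \<le> S(\<Delta>(\<rho>))\<close>. Conversely, if
  \<open>\<rho> = \<Sum>\<^sub>k |y\<^sub>k><y\<^sub>k|\<close>, then \<open>\<rho>\<close> is also the average of the projectors of the random vectors
  \<open>s = \<Sum>\<^sub>k \<plusminus> y\<^sub>k\<close>. The variable \<open>\<bar>s\<^sub>a\<bar>\<^sup>2\<close> has mean \<open>p = \<rho>\<^sub>a\<^sub>a\<close> and second moment at most \<open>3 p\<^sup>2\<close>,
  so the entropy lost is at most \<open>log\<^sub>2 3\<close>, whatever the dimension. Applied to tensor powers this gives
  \<open>C\<^sub>a\<^sup>\<infinity>(\<rho>) = S(\<Delta>(\<rho>))\<close>, and it remains to compare \<open>C\<^sub>a(\<rho>)\<close> with \<open>S(\<Delta>(\<rho>))\<close>.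
  For \<open>d \<le> 3\<close> they agree since every correlation matrix of size three is a mixture of rank one ones.
  For \<open>d \<ge> 4\<close> there is a state of rank two with diagonal \<open>(1/4, 1/4, 1/4, 1/4, 0, \<dots>)\<close> whose range stays
  away from the vectors with this diagonal.
\<close>

section \<open>The entropy function\<close>

text \<open>By strict concavity of \<open>eta\<close>, a finite decomposition attains S(Delta(rho))
  only if every member of positive weight has the diagonal of rho. Dividing entry (a, b) by the root
  of the product of diagonal entries a and b turns this into writing a correlation matrix as a
  mixture of rank one ones. The threshold is that of the extreme correlation matrices: one of rank r
  and size d needs r^2 <= d, so rank two first appears at d = 4. The counterexample is of this kind:
  its rows give four projectors that span the Hermitian 2 x 2 matrices. Showing that no member of a
  decomposition has the right diagonal would not suffice for strictness, since
  \<open>coherence_of_assistance\<close> is a supremum. In place of a compactness argument the proof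
  gives a uniform gap, whence the explicit constants 1/20 and 1/900. For the regularisation, random
  signs replace typical sequences. Their bound holds for every state, so tensor powers enter only
  through additivity of the diagonal entropy and the existence of some decomposition.\<close>

definition eta :: "real \<Rightarrow> real" where
  "eta x = - x * log 2 x"

lemma eta_0 [simp]: "eta 0 = 0"
  and eta_1 [simp]: "eta 1 = 0"
  by (simp_all add: eta_def)

lemma eta_mult:
  assumes "0 \<le> x" "0 \<le> y"
  shows "eta (x * y) = x * eta y + y * eta x"
proof (cases "x = 0 \<or> y = 0")
  case False
  then show ?thesis
    using assms by (simp add: eta_def log_mult algebra_simps)
qed auto

lemma eta_le_tangent:
  assumes "0 \<le> x" "0 < c"
  shows "eta x \<le> - x * log 2 c + (c - x) / ln 2"
proof (cases "x = 0")
  case True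
  then show ?thesis using assms by (simp add: eta_def)
next
  case False
  then have x: "0 < x" using assms by simp
  have "ln (c / x) \<le> c / x - 1"
    using x assms by (intro ln_le_minus_one) simp
  then have "x * (ln c - ln x) \<le> x * (c / x - 1)"
    using x assms by (intro mult_left_mono) (simp_all add: ln_div)
  also have "\<dots> = c - x" using x by (simp add: field_simps)
  finally have "x * (ln c - ln x) / ln 2 \<le> (c - x) / ln 2"
    by (intro divide_right_mono) simp_all
  then show ?thesis
    by (simp add: eta_def log_def field_simps)
qed

text \<open>The lower bound is a parabola touching \<open>eta\<close> at \<open>c\<close>. Being
  quadratic, it averages to an expression in the first two moments only.\<close>

lemma eta_ge_tangent:
  assumes "0 \<le> x" "0 < c"
  shows "- x * log 2 c - (x\<^sup>2 / c - x) / ln 2 \<le> eta x"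
proof (cases "x = 0")
  case True
  then show ?thesis by (simp add: eta_def)
next
  case False
  then have x: "0 < x" using assms by simp
  have "ln (x / c) \<le> x / c - 1"
    using x assms by (intro ln_le_minus_one) simp
  then have "x * (ln x - ln c) \<le> x * (x / c - 1)"
    using x assms by (intro mult_left_mono) (simp_all add: ln_div)
  also have "\<dots> = x\<^sup>2 / c - x" by (simp add: power2_eq_square algebra_simps)
  finally have "x * (ln x - ln c) / ln 2 \<le> (x\<^sup>2 / c - x) / ln 2"
    by (intro divide_right_mono) simp_all
  then show ?thesis
    by (simp add: eta_def log_def field_simps)
qed

lemma weighted_sum_eq_0:
  fixes w x :: "'k \<Rightarrow> real"
  assumes "finite K" "\<And>k. k \<in> K \<Longrightarrow> 0 \<le> w k" "\<And>k. k \<in> K \<Longrightarrow> 0 \<le> x k"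
    and "(\<Sum>k\<in>K. w k * x k) = 0"
  shows "(\<Sum>k\<in>K. w k * eta (x k)) = 0"
proof -
  have "\<forall>k\<in>K. w k * x k = 0"
    using assms by (subst sum_nonneg_eq_0_iff[symmetric]) auto
  then show ?thesis
    by (intro sum.neutral) (auto simp: eta_def)
qed

lemma eta_jensen:
  fixes w x :: "'k \<Rightarrow> real"
  assumes K: "finite K" and w: "\<And>k. k \<in> K \<Longrightarrow> 0 \<le> w k" and x: "\<And>k. k \<in> K \<Longrightarrow> 0 \<le> x k"
    and w1: "(\<Sum>k\<in>K. w k) = 1"
  shows "(\<Sum>k\<in>K. w k * eta (x k)) \<le> eta (\<Sum>k\<in>K. w k * x k)"
proof -
  define c where "c = (\<Sum>k\<in>K. w k * x k)"
  have c0: "0 \<le> c" unfolding c_def using w x by (intro sum_nonneg) auto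
  show ?thesis
  proof (cases "c = 0")
    case True
    then show ?thesis
      using weighted_sum_eq_0[OF K w x] by (simp add: c_def)
  next
    case False
    then have c: "0 < c" using c0 by simp
    have "(\<Sum>k\<in>K. w k * eta (x k))
        \<le> (\<Sum>k\<in>K. w k * (- x k * log 2 c + (c - x k) / ln 2))"
      using w x c by (intro sum_mono mult_left_mono eta_le_tangent) auto
    also have "\<dots> = (\<Sum>k\<in>K. - (log 2 c + 1 / ln 2) * (w k * x k) + c / ln 2 * w k)"
      by (intro sum.cong) (auto simp: field_simps)
    also have "\<dots> = - (log 2 c + 1 / ln 2) * c + c / ln 2 * 1"
      by (simp only: sum.distrib sum_distrib_left[symmetric] c_def[symmetric] w1)
    also have "\<dots> = eta c" by (simp add: eta_def algebra_simps)
    finally show ?thesis by (simp add: c_def)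
  qed
qed

text \<open>The parabola of \<open>eta_ge_tangent\<close> is placed at \<open>c = 3 * p\<close>, the
  best point when the second moment equals \<open>3 * p^2\<close>. Its average is then at least
  \<open>- p * log 2 (3 * p)\<close>.\<close>

lemma eta_reverse_jensen:
  fixes w x :: "'k \<Rightarrow> real"
  assumes K: "finite K" and w: "\<And>k. k \<in> K \<Longrightarrow> 0 \<le> w k" and x: "\<And>k. k \<in> K \<Longrightarrow> 0 \<le> x k"
    and p: "(\<Sum>k\<in>K. w k * x k) = p" and p2: "(\<Sum>k\<in>K. w k * (x k)\<^sup>2) \<le> 3 * p\<^sup>2"
  shows "eta p - p * log 2 3 \<le> (\<Sum>k\<in>K. w k * eta (x k))"
proof (cases "p = 0")
  case True
  then show ?thesis
    using weighted_sum_eq_0[OF K w x] p by simp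
next
  case False
  have "0 \<le> p" unfolding p[symmetric] using w x by (intro sum_nonneg) auto
  then have p0: "0 < p" using False by simp
  have "(\<Sum>k\<in>K. w k * (x k)\<^sup>2) / (3 * p) \<le> 3 * p\<^sup>2 / (3 * p)"
    using p0 p2 by (intro divide_right_mono) auto
  also have "\<dots> = p" using p0 by (simp add: power2_eq_square)
  finally have "((\<Sum>k\<in>K. w k * (x k)\<^sup>2) / (3 * p) - p) / ln 2 \<le> 0"
    by (simp add: divide_nonpos_pos)
  moreover have "eta p - p * log 2 3 = - p * log 2 (3 * p)"
    using p0 by (simp add: eta_def log_mult algebra_simps)
  moreover have "(\<Sum>k\<in>K. w k * (- x k * log 2 (3 * p) - ((x k)\<^sup>2 / (3 * p) - x k) / ln 2))
      = - p * log 2 (3 * p) - ((\<Sum>k\<in>K. w k * (x k)\<^sup>2) / (3 * p) - p) / ln 2"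
  proof -
    have "(\<Sum>k\<in>K. w k * (- x k * log 2 (3 * p) - ((x k)\<^sup>2 / (3 * p) - x k) / ln 2))
       = (\<Sum>k\<in>K. (1 / ln 2 - log 2 (3 * p)) * (w k * x k) - 1 / (3 * p) / ln 2 * (w k * (x k)\<^sup>2))"
      by (intro sum.cong) (auto simp: diff_divide_distrib algebra_simps)
    also have "\<dots> = (1 / ln 2 - log 2 (3 * p)) * p - 1 / (3 * p) / ln 2 * (\<Sum>k\<in>K. w k * (x k)\<^sup>2)"
      by (simp only: sum_subtractf sum_distrib_left[symmetric] p)
    finally show ?thesis by (simp add: diff_divide_distrib algebra_simps)
  qed
  moreover have "(\<Sum>k\<in>K. w k * (- x k * log 2 (3 * p) - ((x k)\<^sup>2 / (3 * p) - x k) / ln 2))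
      \<le> (\<Sum>k\<in>K. w k * eta (x k))"
    using w x p0 by (intro sum_mono mult_left_mono eta_ge_tangent) auto
  ultimately show ?thesis by linarith
qed

section \<open>Decompositions into unnormalised vectors\<close>

definition diagonal_entropy :: "complex mat \<Rightarrow> real" where
  "diagonal_entropy X = (\<Sum>a<dim_row X. eta (Re (X $$ (a, a))))"

lemma von_neumann_entropy_dephase:
  "von_neumann_entropy (dephase X) = diagonal_entropy X"
proof -
  define n where "n = dim_row X"
  have carrier: "dephase X \<in> carrier_mat n n"
    by (simp add: dephase_def n_def)
  have "char_poly (dephase X) = (\<Prod>a\<leftarrow>diag_mat (dephase X). [:- a, 1:])"
    by (rule char_poly_upper_triangular[OF carrier])
       (auto simp: dephase_def mat_diag_def)
  also have "diag_mat (dephase X) = map (\<lambda>i. X $$ (i, i)) [0..<n]"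
    by (auto simp: diag_mat_def dephase_def mat_diag_def n_def)
  finally have cp: "char_poly (dephase X) = (\<Prod>a\<leftarrow>map (\<lambda>i. X $$ (i, i)) [0..<n]. [:- a, 1:])" .
  have pr: "proots (\<Prod>a\<leftarrow>xs. [:- a, 1:]) = mset xs" for xs :: "complex list"
  proof (induction xs)
    case (Cons a xs)
    have "(\<Prod>a\<leftarrow>xs. [:- a, 1:]) \<noteq> (0 :: complex poly)"
      by auto
    then show ?case
      using Cons by (simp add: proots_mult del: mult_pCons_left)
  qed simp
  have "von_neumann_entropy (dephase X)
      = - (\<Sum>i\<leftarrow>[0..<n]. Re (X $$ (i, i)) * log 2 (Re (X $$ (i, i))))"
    unfolding von_neumann_entropy_def cp pr
    by (simp add: sum_mset_sum_list[symmetric] comp_def mset_map[symmetric] del: mset_map)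
  also have "\<dots> = diagonal_entropy X"
    by (simp add: diagonal_entropy_def eta_def n_def sum_negf interv_sum_list_conv_sum_set_nat
        atLeast0LessThan)
  finally show ?thesis .
qed

lemma mult_cnj_cmod: "z * cnj z = of_real ((cmod z)\<^sup>2)"
  by (simp only: complex_norm_square)

lemma von_neumann_entropy_ket_bra:
  "von_neumann_entropy (dephase (ket_bra v)) = (\<Sum>a<dim_vec v. eta ((cmod (v $ a))\<^sup>2))"
  unfolding von_neumann_entropy_dephase diagonal_entropy_def
  by (intro sum.cong) (auto simp: ket_bra_def mult_cnj_cmod)

lemma unit_vector_iff:
  "unit_vector d v \<longleftrightarrow> dim_vec v = d \<and> (\<Sum>a<d. (cmod (v $ a))\<^sup>2) = 1"
proof -
  have "v \<bullet>c v = of_real (\<Sum>a<dim_vec v. (cmod (v $ a))\<^sup>2)"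
    by (simp add: scalar_prod_def mult_cnj_cmod atLeast0LessThan)
  then have "v \<bullet>c v = 1 \<longleftrightarrow> (\<Sum>a<dim_vec v. (cmod (v $ a))\<^sup>2) = 1"
    by (simp only: of_real_eq_1_iff)
  moreover have "v \<in> carrier_vec d \<longleftrightarrow> dim_vec v = d"
    using carrier_vecI carrier_vecD by blast
  ultimately show ?thesis
    unfolding unit_vector_def by blast
qed

text \<open>The vectors \<open>y k\<close> need not be normalised.\<close>

definition vector_decomposition ::
  "complex mat \<Rightarrow> 'k set \<Rightarrow> ('k \<Rightarrow> real) \<Rightarrow> ('k \<Rightarrow> nat \<Rightarrow> complex) \<Rightarrow> bool" where
  "vector_decomposition \<rho> K w y \<longleftrightarrow>
     \<rho> \<in> carrier_mat (dim_row \<rho>) (dim_row \<rho>) \<and> finite K \<and> (\<forall>k\<in>K. 0 \<le> w k) \<and>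
     (\<forall>a<dim_row \<rho>. \<forall>b<dim_row \<rho>. \<rho> $$ (a, b) = (\<Sum>k\<in>K. of_real (w k) * y k a * cnj (y k b))) \<and>
     mat_trace \<rho> = 1"

lemma vector_decomposition_diag:
  assumes "vector_decomposition \<rho> K w y" "a < dim_row \<rho>"
  shows "\<rho> $$ (a, a) = of_real (\<Sum>k\<in>K. w k * (cmod (y k a))\<^sup>2)"
  using assms
  by (simp add: vector_decomposition_def mult.assoc mult_cnj_cmod)

lemma vector_decomposition_total:
  assumes "vector_decomposition \<rho> K w y"
  shows "(\<Sum>k\<in>K. w k * (\<Sum>a<dim_row \<rho>. (cmod (y k a))\<^sup>2)) = 1"
proof -
  have "1 = Re (mat_trace \<rho>)" using assms by (simp add: vector_decomposition_def)
  also have "\<dots> = (\<Sum>a<dim_row \<rho>. \<Sum>k\<in>K. w k * (cmod (y k a))\<^sup>2)"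
    using vector_decomposition_diag[OF assms] by (simp add: mat_trace_def)
  finally show ?thesis by (simp add: sum.swap[of _ K] sum_distrib_left)
qed

lemma pure_state_imp_vector_decomposition:
  assumes "pure_state_decomposition \<rho> m p \<psi>"
  shows "vector_decomposition \<rho> {..<m} p (\<lambda>k a. \<psi> k $ a)"
proof -
  define d where "d = dim_row \<rho>"
  have u: "unit_vector d (\<psi> k)" "0 \<le> p k" if "k < m" for k
    using assms that by (auto simp: pure_state_decomposition_def d_def)
  have rho: "\<rho> = mat d d (\<lambda>(a, b). \<Sum>i<m. complex_of_real (p i) * ket_bra (\<psi> i) $$ (a, b))"
    using assms unfolding pure_state_decomposition_def d_def by blast
  have ent: "\<rho> $$ (a, b) = (\<Sum>k<m. of_real (p k) * \<psi> k $ a * cnj (\<psi> k $ b))"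
    if "a < d" "b < d" for a b
    by (subst rho) (use that u in \<open>auto simp: ket_bra_def unit_vector_iff mult.assoc intro!: sum.cong\<close>)
  have "mat_trace \<rho> = (\<Sum>a<d. \<Sum>k<m. of_real (p k * (cmod (\<psi> k $ a))\<^sup>2))"
    by (simp add: mat_trace_def d_def[symmetric] ent mult.assoc mult_cnj_cmod)
  also have "\<dots> = of_real (\<Sum>k<m. p k * (\<Sum>a<d. (cmod (\<psi> k $ a))\<^sup>2))"
    by (subst sum.swap) (simp add: sum_distrib_left)
  also have "(\<Sum>k<m. p k * (\<Sum>a<d. (cmod (\<psi> k $ a))\<^sup>2)) = (\<Sum>k<m. p k)"
    using u by (intro sum.cong) (auto simp: unit_vector_iff)
  also have "\<dots> = 1" using assms by (simp add: pure_state_decomposition_def)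
  finally have tr: "mat_trace \<rho> = 1" by simp
  have "\<rho> \<in> carrier_mat d d" by (subst rho) simp
  then show ?thesis
    unfolding vector_decomposition_def d_def[symmetric]
    using u ent tr by simp
qed

lemma average_entropy_le_diagonal_entropy:
  assumes "pure_state_decomposition \<rho> m p \<psi>"
  shows "(\<Sum>i<m. p i * von_neumann_entropy (dephase (ket_bra (\<psi> i)))) \<le> diagonal_entropy \<rho>"
proof -
  define d where "d = dim_row \<rho>"
  have u: "unit_vector d (\<psi> k)" "0 \<le> p k" if "k < m" for k
    using assms that by (auto simp: pure_state_decomposition_def d_def)
  note diag = vector_decomposition_diag[OF pure_state_imp_vector_decomposition[OF assms]]
  have "(\<Sum>i<m. p i * von_neumann_entropy (dephase (ket_bra (\<psi> i))))
      = (\<Sum>i<m. \<Sum>a<d. p i * eta ((cmod (\<psi> i $ a))\<^sup>2))"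
    using u by (intro sum.cong) (auto simp: von_neumann_entropy_ket_bra unit_vector_iff sum_distrib_left)
  also have "\<dots> = (\<Sum>a<d. \<Sum>i<m. p i * eta ((cmod (\<psi> i $ a))\<^sup>2))"
    by (rule sum.swap)
  also have "\<dots> \<le> (\<Sum>a<d. eta (\<Sum>i<m. p i * (cmod (\<psi> i $ a))\<^sup>2))"
    using u assms by (intro sum_mono eta_jensen) (auto simp: pure_state_decomposition_def)
  also have "\<dots> = diagonal_entropy \<rho>"
    unfolding diagonal_entropy_def d_def[symmetric]
    by (intro sum.cong) (auto simp: diag d_def)
  finally show ?thesis .
qed

lemma average_entropy_le_coherence:
  assumes "pure_state_decomposition \<rho> m p \<psi>"
  shows "(\<Sum>i<m. p i * von_neumann_entropy (dephase (ket_bra (\<psi> i)))) \<le> coherence_of_assistance \<rho>"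
  unfolding coherence_of_assistance_def
proof (rule cSup_upper)
  show "bdd_above {(\<Sum>i<m. p i * von_neumann_entropy (dephase (ket_bra (\<psi> i)))) | m p \<psi>.
            pure_state_decomposition \<rho> m p \<psi>}"
    using average_entropy_le_diagonal_entropy by (intro bdd_aboveI) blast
qed (use assms in blast)

text \<open>If y has squared norm q, then q times the entropy of y / sqrt q is
  \<open>(\<Sum>a. eta (|y a|^2)) - eta q\<close>, by the product rule \<open>eta_mult\<close>. This
  form avoids normalising in later computations.\<close>

lemma vector_imp_pure_state_decomposition:
  assumes "vector_decomposition \<rho> K w y"
  defines "d \<equiv> dim_row \<rho>"
  shows "\<exists>m p \<psi>. pure_state_decomposition \<rho> m p \<psi> \<and>
    (\<Sum>i<m. p i * von_neumann_entropy (dephase (ket_bra (\<psi> i))))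
    = (\<Sum>k\<in>K. w k * ((\<Sum>a<d. eta ((cmod (y k a))\<^sup>2)) - eta (\<Sum>a<d. (cmod (y k a))\<^sup>2)))"
proof -
  have K: "finite K" and w: "\<And>k. k \<in> K \<Longrightarrow> 0 \<le> w k"
    and rho: "\<rho> \<in> carrier_mat d d"
    and ent: "\<And>a b. a < d \<Longrightarrow> b < d \<Longrightarrow>
      \<rho> $$ (a, b) = (\<Sum>k\<in>K. of_real (w k) * y k a * cnj (y k b))"
    and tr: "mat_trace \<rho> = 1"
    using assms(1) by (auto simp: vector_decomposition_def d_def)
  have d: "0 < d" using tr by (cases "d = 0") (auto simp: mat_trace_def d_def)
  obtain m :: nat and f where f: "bij_betw f {..<m} K"
    using ex_bij_betw_nat_finite[OF K] by (auto simp: atLeast0LessThan)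
  define q where "q k = (\<Sum>a<d. (cmod (y k a))\<^sup>2)" for k
  \<comment> \<open>A zero vector cannot be normalised. Any unit vector may replace it, because its
    weight \<open>w k * q k\<close> vanishes.\<close>
  define \<phi> where "\<phi> k = (if q k = 0 then unit_vec d 0
    else vec d (\<lambda>a. y k a / of_real (sqrt (q k))))" for k
  have q0: "0 \<le> q k" for k by (simp add: q_def sum_nonneg)
  have y0: "y k a = 0" if "q k = 0" "a < d" for k a
  proof -
    have "\<forall>a\<in>{..<d}. (cmod (y k a))\<^sup>2 = 0"
      using that by (subst sum_nonneg_eq_0_iff[symmetric]) (auto simp: q_def)
    then show ?thesis using that by simp
  qed
  have nrm: "(cmod (\<phi> k $ a))\<^sup>2 = (cmod (y k a))\<^sup>2 / q k" if "q k \<noteq> 0" "a < d" for k a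
    using that q0[of k] by (simp add: \<phi>_def norm_divide power_divide)
  have dim: "dim_vec (\<phi> k) = d" for k by (simp add: \<phi>_def)
  have unit: "unit_vector d (\<phi> k)" for k
  proof (cases "q k = 0")
    case True
    then show ?thesis using d by (auto simp: \<phi>_def unit_vector_def)
  next
    case False
    have "(\<Sum>a<d. (cmod (\<phi> k $ a))\<^sup>2) = (\<Sum>a<d. (cmod (y k a))\<^sup>2) / q k"
      using False by (simp add: nrm sum_divide_distrib)
    also have "\<dots> = 1" using False by (simp add: q_def)
    finally show ?thesis by (simp add: unit_vector_iff dim)
  qed
  have proj: "complex_of_real (w k * q k) * ket_bra (\<phi> k) $$ (a, b) = of_real (w k) * y k a * cnj (y k b)"
    if "a < d" "b < d" for k a b
  proof (cases "q k = 0")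
    case True
    then show ?thesis using y0 that by simp
  next
    case False
    have "complex_of_real (sqrt (q k)) * complex_of_real (sqrt (q k)) = of_real (q k)"
      using q0[of k] by (simp flip: of_real_mult)
    then show ?thesis using False that q0[of k]
      by (simp add: ket_bra_def dim) (simp add: \<phi>_def field_simps)
  qed
  have "(\<Sum>i<m. w (f i) * q (f i)) = (\<Sum>k\<in>K. w k * q k)"
    by (rule sum.reindex_bij_betw[OF f])
  also have "\<dots> = 1" using vector_decomposition_total[OF assms(1)] by (simp add: q_def d_def)
  finally have tot: "(\<Sum>i<m. w (f i) * q (f i)) = 1" .
  have fK: "f i \<in> K" if "i < m" for i using f that by (auto simp: bij_betw_def)
  have "\<rho> = mat d d (\<lambda>(a, b). \<Sum>i<m. complex_of_real (w (f i) * q (f i)) * ket_bra (\<phi> (f i)) $$ (a, b))"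
  proof (rule eq_matI)
    fix a b assume "a < dim_row (mat d d (\<lambda>(a, b). \<Sum>i<m. complex_of_real (w (f i) * q (f i)) * ket_bra (\<phi> (f i)) $$ (a, b)))"
      "b < dim_col (mat d d (\<lambda>(a, b). \<Sum>i<m. complex_of_real (w (f i) * q (f i)) * ket_bra (\<phi> (f i)) $$ (a, b)))"
    then have ab: "a < d" "b < d" by auto
    have "(\<Sum>i<m. complex_of_real (w (f i) * q (f i)) * ket_bra (\<phi> (f i)) $$ (a, b))
        = (\<Sum>k\<in>K. complex_of_real (w k * q k) * ket_bra (\<phi> k) $$ (a, b))"
      by (rule sum.reindex_bij_betw[OF f])
    also have "\<dots> = \<rho> $$ (a, b)" by (simp only: proj[OF ab] ent[OF ab])
    finally show "\<rho> $$ (a, b) = mat d d (\<lambda>(a, b). \<Sum>i<m. complex_of_real (w (f i) * q (f i)) * ket_bra (\<phi> (f i)) $$ (a, b)) $$ (a, b)"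
      using ab by simp
  qed (use rho in auto)
  then have pure: "pure_state_decomposition \<rho> m (\<lambda>i. w (f i) * q (f i)) (\<lambda>i. \<phi> (f i))"
    using w fK q0 unit tot unfolding pure_state_decomposition_def d_def by auto
  have val: "w k * q k * von_neumann_entropy (dephase (ket_bra (\<phi> k)))
      = w k * ((\<Sum>a<d. eta ((cmod (y k a))\<^sup>2)) - eta (q k))" for k
  proof (cases "q k = 0")
    case True
    then show ?thesis using y0[OF True] by simp
  next
    case False
    then have qp: "0 < q k" using q0[of k] by simp
    have "q k * eta ((cmod (y k a))\<^sup>2 / q k)
        = eta ((cmod (y k a))\<^sup>2) + (cmod (y k a))\<^sup>2 * log 2 (q k)" for a
      using eta_mult[of "q k" "(cmod (y k a))\<^sup>2 / q k"] qp by (simp add: eta_def algebra_simps)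
    then have "q k * von_neumann_entropy (dephase (ket_bra (\<phi> k)))
        = (\<Sum>a<d. eta ((cmod (y k a))\<^sup>2) + (cmod (y k a))\<^sup>2 * log 2 (q k))"
      using False by (simp add: von_neumann_entropy_ket_bra dim nrm sum_distrib_left)
    also have "\<dots> = (\<Sum>a<d. eta ((cmod (y k a))\<^sup>2)) - eta (q k)"
      by (simp only: sum.distrib sum_distrib_right[symmetric] q_def[symmetric])
         (simp add: eta_def)
    finally show ?thesis by simp
  qed
  have avg: "(\<Sum>i<m. w (f i) * q (f i) * von_neumann_entropy (dephase (ket_bra (\<phi> (f i)))))
     = (\<Sum>k\<in>K. w k * ((\<Sum>a<d. eta ((cmod (y k a))\<^sup>2)) - eta (q k)))"
    unfolding val[symmetric]
    using sum.reindex_bij_betw[OF f, of "\<lambda>k. w k * q k * von_neumann_entropy (dephase (ket_bra (\<phi> k)))"]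
    by (simp only:)
  show ?thesis
    unfolding q_def[symmetric]
    by (rule exI[of _ m], rule exI[of _ "\<lambda>i. w (f i) * q (f i)"], rule exI[of _ "\<lambda>i. \<phi> (f i)"],
        rule conjI, rule pure, rule avg)
qed

lemma vector_decomposition_le_coherence:
  assumes "vector_decomposition \<rho> K w y"
  defines "d \<equiv> dim_row \<rho>"
  shows "(\<Sum>k\<in>K. w k * ((\<Sum>a<d. eta ((cmod (y k a))\<^sup>2)) - eta (\<Sum>a<d. (cmod (y k a))\<^sup>2)))
    \<le> coherence_of_assistance \<rho>"
proof -
  obtain m p \<psi> where
    "pure_state_decomposition \<rho> m p \<psi>"
    "(\<Sum>i<m. p i * von_neumann_entropy (dephase (ket_bra (\<psi> i))))
    = (\<Sum>k\<in>K. w k * ((\<Sum>a<d. eta ((cmod (y k a))\<^sup>2)) - eta (\<Sum>a<d. (cmod (y k a))\<^sup>2)))"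
    using vector_imp_pure_state_decomposition[OF assms(1)] unfolding d_def by (elim exE conjE)
  with average_entropy_le_coherence[OF this(1)] show ?thesis by (simp only:)
qed

text \<open>The decomposition supplies an element of the set, without which a bound on all elements
  would say nothing about \<open>Sup\<close>.\<close>

lemma coherence_le_diagonal_entropy:
  assumes "vector_decomposition \<rho> K w y"
  shows "coherence_of_assistance \<rho> \<le> diagonal_entropy \<rho>"
  unfolding coherence_of_assistance_def
proof (rule cSup_least)
  obtain m p \<psi> where "pure_state_decomposition \<rho> m p \<psi>"
    using vector_imp_pure_state_decomposition[OF assms] by (elim exE conjE)
  then have "(\<Sum>i<m. p i * von_neumann_entropy (dephase (ket_bra (\<psi> i))))
      \<in> {(\<Sum>i<m. p i * von_neumann_entropy (dephase (ket_bra (\<psi> i)))) | m p \<psi>.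
      pure_state_decomposition \<rho> m p \<psi>}"
    by blast
  then show "{(\<Sum>i<m. p i * von_neumann_entropy (dephase (ket_bra (\<psi> i)))) | m p \<psi>.
      pure_state_decomposition \<rho> m p \<psi>} \<noteq> {}"
    by (simp only: ex_in_conv[symmetric]) (rule exI)
next
  fix x
  assume "x \<in> {(\<Sum>i<m. p i * von_neumann_entropy (dephase (ket_bra (\<psi> i)))) | m p \<psi>.
      pure_state_decomposition \<rho> m p \<psi>}"
  then obtain m p \<psi> where
    "x = (\<Sum>i<m. p i * von_neumann_entropy (dephase (ket_bra (\<psi> i))))"
    "pure_state_decomposition \<rho> m p \<psi>"
    by blast
  then show "x \<le> diagonal_entropy \<rho>"
    using average_entropy_le_diagonal_entropy[of \<rho> m p \<psi>] by (simp only:)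
qed

section \<open>Random signs\<close>

text \<open>A sign pattern is encoded by the set of indices with sign plus, so expectations over
  independent fair signs become averages over \<open>Pow {..<r}\<close>.\<close>

definition signed_sum :: "(nat \<Rightarrow> complex) \<Rightarrow> nat \<Rightarrow> nat set \<Rightarrow> complex" where
  "signed_sum f r A = (\<Sum>k<r. if k \<in> A then f k else - f k)"

lemma signed_sum_Suc:
  assumes "A \<subseteq> {..<r}"
  shows "signed_sum f (Suc r) A = signed_sum f r A - f r"
    and "signed_sum f (Suc r) (insert r A) = signed_sum f r A + f r"
proof -
  have "(\<Sum>k<r. if k = r \<or> k \<in> A then f k else - f k) = (\<Sum>k<r. if k \<in> A then f k else - f k)"
    by (intro sum.cong) auto
  then show "signed_sum f (Suc r) A = signed_sum f r A - f r"
    "signed_sum f (Suc r) (insert r A) = signed_sum f r A + f r"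
    using assms by (auto simp: signed_sum_def)
qed

lemma sum_Pow_Suc:
  fixes F :: "nat set \<Rightarrow> 'a :: comm_monoid_add"
  shows "(\<Sum>A\<in>Pow {..<Suc r}. F A) = (\<Sum>A\<in>Pow {..<r}. F A + F (insert r A))"
proof -
  have "(\<Sum>A\<in>Pow {..<Suc r}. F A) = (\<Sum>A\<in>Pow {..<r}. F A) + (\<Sum>A\<in>insert r ` Pow {..<r}. F A)"
    unfolding lessThan_Suc Pow_insert by (intro sum.union_disjoint) auto
  also have "(\<Sum>A\<in>insert r ` Pow {..<r}. F A) = (\<Sum>A\<in>Pow {..<r}. F (insert r A))"
    by (rule sum.reindex_cong[where l = "insert r"]) (auto simp: inj_on_def)
  finally show ?thesis by (simp add: sum.distrib)
qed

lemma signed_sum_correlation: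
  "(\<Sum>A\<in>Pow {..<r}. signed_sum f r A * cnj (signed_sum g r A)) = 2 ^ r * (\<Sum>k<r. f k * cnj (g k))"
proof (induction r)
  case 0
  then show ?case by (simp add: signed_sum_def)
next
  case (Suc r)
  have "(\<Sum>A\<in>Pow {..<Suc r}. signed_sum f (Suc r) A * cnj (signed_sum g (Suc r) A))
      = (\<Sum>A\<in>Pow {..<r}. 2 * (signed_sum f r A * cnj (signed_sum g r A)) + 2 * (f r * cnj (g r)))"
    unfolding sum_Pow_Suc by (intro sum.cong) (auto simp: signed_sum_Suc algebra_simps)
  also have "\<dots> = 2 ^ Suc r * (\<Sum>k<Suc r. f k * cnj (g k))"
    by (simp add: sum.distrib sum_distrib_left[symmetric] Suc card_Pow algebra_simps)
  finally show ?case .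
qed

lemma signed_sum_second_moment:
  "(\<Sum>A\<in>Pow {..<r}. (cmod (signed_sum f r A))\<^sup>2) = 2 ^ r * (\<Sum>k<r. (cmod (f k))\<^sup>2)"
proof -
  have "complex_of_real (\<Sum>A\<in>Pow {..<r}. (cmod (signed_sum f r A))\<^sup>2)
      = of_real (2 ^ r * (\<Sum>k<r. (cmod (f k))\<^sup>2))"
    using signed_sum_correlation[of f r f] by (simp add: mult_cnj_cmod)
  then show ?thesis by (simp only: of_real_eq_iff)
qed

text \<open>Averaging over the sign of z removes the terms odd in z. Cauchy-Schwarz for the cross
  term c leaves the binomial coefficient 6, with equality when s and z are real.\<close>

lemma fourth_power_parallelogram:
  "(cmod (s - z)) ^ 4 + (cmod (s + z)) ^ 4
    \<le> 2 * ((cmod s) ^ 4 + 6 * (cmod s)\<^sup>2 * (cmod z)\<^sup>2 + (cmod z) ^ 4)"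
proof -
  define P c where "P = (cmod s)\<^sup>2 + (cmod z)\<^sup>2" and "c = Re (s * cnj z)"
  have "\<bar>c\<bar> \<le> cmod s * cmod z"
    using abs_Re_le_cmod[of "s * cnj z"] by (simp add: c_def norm_mult)
  then have "c\<^sup>2 \<le> (cmod s * cmod z)\<^sup>2"
    by (rule power2_le_iff_abs_le[THEN iffD2, rotated]) simp
  then have c: "c\<^sup>2 \<le> (cmod s)\<^sup>2 * (cmod z)\<^sup>2" by (simp add: power_mult_distrib)
  have "(cmod (s - z))\<^sup>2 = P - 2 * c" "(cmod (s + z))\<^sup>2 = P + 2 * c"
    unfolding P_def c_def cmod_power2 by (simp_all add: power2_eq_square algebra_simps)
  moreover have pow4: "x ^ 4 = (x\<^sup>2)\<^sup>2" for x :: real by simp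
  ultimately have "(cmod (s - z)) ^ 4 + (cmod (s + z)) ^ 4 = (P - 2 * c)\<^sup>2 + (P + 2 * c)\<^sup>2"
    by (simp only:)
  also have "\<dots> = 2 * P\<^sup>2 + 8 * c\<^sup>2" by (simp add: power2_eq_square algebra_simps)
  also have "\<dots> \<le> 2 * P\<^sup>2 + 8 * ((cmod s)\<^sup>2 * (cmod z)\<^sup>2)" using c by simp
  also have "\<dots> = 2 * ((cmod s) ^ 4 + 6 * (cmod s)\<^sup>2 * (cmod z)\<^sup>2 + (cmod z) ^ 4)"
    unfolding P_def pow4 by (simp add: power2_eq_square algebra_simps)
  finally show ?thesis .
qed

text \<open>Khinchine's inequality for the fourth moment: conditioning on the last sign gives an
  induction in which the constant 3 reproduces itself. Since the bound is relative to the squared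
  variance, neither the number of vectors nor the dimension enters.\<close>

lemma signed_sum_fourth_moment:
  "(\<Sum>A\<in>Pow {..<r}. (cmod (signed_sum f r A)) ^ 4) \<le> 3 * 2 ^ r * (\<Sum>k<r. (cmod (f k))\<^sup>2)\<^sup>2"
proof (induction r)
  case 0
  then show ?case by (simp add: signed_sum_def)
next
  case (Suc r)
  define z where "z = (cmod (f r))\<^sup>2"
  define V where "V = (\<Sum>k<r. (cmod (f k))\<^sup>2)"
  have z4: "(cmod (f r)) ^ 4 = z\<^sup>2" by (simp add: z_def)
  have "(\<Sum>A\<in>Pow {..<Suc r}. (cmod (signed_sum f (Suc r) A)) ^ 4)
      = (\<Sum>A\<in>Pow {..<r}. (cmod (signed_sum f r A - f r)) ^ 4 + (cmod (signed_sum f r A + f r)) ^ 4)"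
    unfolding sum_Pow_Suc by (intro sum.cong) (auto simp: signed_sum_Suc)
  also have "\<dots> \<le> (\<Sum>A\<in>Pow {..<r}. 2 * ((cmod (signed_sum f r A)) ^ 4
      + 6 * (cmod (signed_sum f r A))\<^sup>2 * (cmod (f r))\<^sup>2 + (cmod (f r)) ^ 4))"
    by (intro sum_mono fourth_power_parallelogram)
  also have "\<dots> = (\<Sum>A\<in>Pow {..<r}. 2 * (cmod (signed_sum f r A)) ^ 4
      + 12 * z * (cmod (signed_sum f r A))\<^sup>2 + 2 * z\<^sup>2)"
    by (intro sum.cong) (simp_all add: z4 z_def[symmetric] algebra_simps)
  also have "\<dots> = 2 * (\<Sum>A\<in>Pow {..<r}. (cmod (signed_sum f r A)) ^ 4) + 12 * z * (2 ^ r * V) + 2 * z\<^sup>2 * 2 ^ r"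
    by (simp add: sum.distrib sum_distrib_left[symmetric] signed_sum_second_moment V_def card_Pow)
  also have "\<dots> \<le> 2 * (3 * 2 ^ r * V\<^sup>2) + 12 * z * (2 ^ r * V) + 2 * z\<^sup>2 * 2 ^ r"
    using Suc by (simp add: V_def)
  also have "\<dots> = 2 ^ r * (6 * V\<^sup>2 + 12 * z * V + 2 * z\<^sup>2)" by (simp add: algebra_simps)
  \<comment> \<open>Enlarging \<open>2 * z^2\<close> to \<open>6 * z^2\<close> completes the square
    \<open>6 * (V + z)^2\<close>.\<close>
  also have "\<dots> \<le> 2 ^ r * (6 * V\<^sup>2 + 12 * z * V + 6 * z\<^sup>2)" by (intro mult_left_mono) auto
  also have "\<dots> = 3 * 2 ^ Suc r * (V + z)\<^sup>2" by (simp add: power2_eq_square algebra_simps)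
  also have "V + z = (\<Sum>k<Suc r. (cmod (f k))\<^sup>2)" by (simp add: V_def z_def)
  finally show ?case .
qed

lemma random_sign_decomposition:
  assumes "vector_decomposition \<rho> {..<m} w y"
  shows "vector_decomposition \<rho> (Pow {..<m}) (\<lambda>_. 1 / 2 ^ m)
    (\<lambda>A a. signed_sum (\<lambda>k. of_real (sqrt (w k)) * y k a) m A)"
proof -
  have "\<rho> $$ (a, b) = (\<Sum>A\<in>Pow {..<m}. of_real (1 / 2 ^ m) *
      signed_sum (\<lambda>k. of_real (sqrt (w k)) * y k a) m A *
      cnj (signed_sum (\<lambda>k. of_real (sqrt (w k)) * y k b) m A))"
    if "a < dim_row \<rho>" "b < dim_row \<rho>" for a b
  proof -
    have sq: "complex_of_real (sqrt (w k)) * of_real (sqrt (w k)) = of_real (w k)" if "k < m" for k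
      using assms that by (simp add: vector_decomposition_def flip: of_real_mult)
    have "\<rho> $$ (a, b) = (\<Sum>k<m. of_real (w k) * y k a * cnj (y k b))"
      using assms that by (simp add: vector_decomposition_def)
    also have "\<dots> = (\<Sum>k<m. (of_real (sqrt (w k)) * y k a) * cnj (of_real (sqrt (w k)) * y k b))"
      by (intro sum.cong) (auto simp: sq[symmetric] mult_ac)
    finally show ?thesis
      unfolding mult.assoc sum_distrib_left[symmetric] signed_sum_correlation
      by simp
  qed
  then show ?thesis
    using assms unfolding vector_decomposition_def by simp
qed

text \<open>Diagonal entry a loses at most its own value times \<open>log 2 3\<close>. As the trace
  is one, the losses add up to at most \<open>log 2 3\<close>.\<close>

lemma coherence_ge:
  assumes "pure_state_decomposition \<rho> m p \<psi>"
  shows "diagonal_entropy \<rho> - log 2 3 \<le> coherence_of_assistance \<rho>"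
proof -
  define d where "d = dim_row \<rho>"
  define u where "u a = (\<lambda>k. complex_of_real (sqrt (p k)) * \<psi> k $ a)" for a
  define s where "s A a = signed_sum (u a) m A" for A a
  define W where "W = (1 :: real) / 2 ^ m"
  have y: "vector_decomposition \<rho> {..<m} p (\<lambda>k a. \<psi> k $ a)"
    using assms by (rule pure_state_imp_vector_decomposition)
  have dec: "vector_decomposition \<rho> (Pow {..<m}) (\<lambda>_. W) s"
    using random_sign_decomposition[OF y] by (simp add: s_def[abs_def] u_def W_def)
  have W: "0 \<le> W" "W * 2 ^ m = 1" "(\<Sum>A\<in>Pow {..<m}. W) = 1"
    by (simp_all add: W_def card_Pow)
  have sum_u: "(\<Sum>A\<in>Pow {..<m}. W * (cmod (s A a))\<^sup>2) = (\<Sum>k<m. (cmod (u a k))\<^sup>2)" for a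
    using W(2) by (simp add: sum_distrib_left[symmetric] s_def signed_sum_second_moment mult.assoc[symmetric])
  have pa: "Re (\<rho> $$ (a, a)) = (\<Sum>k<m. (cmod (u a k))\<^sup>2)" if "a < d" for a
    using vector_decomposition_diag[OF dec] that sum_u by (simp add: d_def)
  have "(\<Sum>A\<in>Pow {..<m}. W * ((cmod (s A a))\<^sup>2)\<^sup>2) \<le> 3 * (\<Sum>k<m. (cmod (u a k))\<^sup>2)\<^sup>2" for a
  proof -
    have "(\<Sum>A\<in>Pow {..<m}. W * ((cmod (s A a))\<^sup>2)\<^sup>2)
        = W * (\<Sum>A\<in>Pow {..<m}. (cmod (signed_sum (u a) m A)) ^ 4)"
      by (simp add: sum_distrib_left[symmetric] s_def)
    also have "\<dots> \<le> W * (3 * 2 ^ m * (\<Sum>k<m. (cmod (u a k))\<^sup>2)\<^sup>2)"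
      by (intro mult_left_mono signed_sum_fourth_moment W)
    also have "\<dots> = (W * 2 ^ m) * (3 * (\<Sum>k<m. (cmod (u a k))\<^sup>2)\<^sup>2)" by simp
    finally show ?thesis by (simp only: W mult_1)
  qed
  then have ent: "eta (Re (\<rho> $$ (a, a))) - Re (\<rho> $$ (a, a)) * log 2 3
      \<le> (\<Sum>A\<in>Pow {..<m}. W * eta ((cmod (s A a))\<^sup>2))" if "a < d" for a
    using that W sum_u by (intro eta_reverse_jensen) (auto simp: pa)
  have "(\<Sum>a<d. Re (\<rho> $$ (a, a))) = Re (mat_trace \<rho>)"
    by (simp add: mat_trace_def d_def)
  also have "\<dots> = 1" using y by (simp add: vector_decomposition_def)
  finally have tr: "(\<Sum>a<d. Re (\<rho> $$ (a, a))) = 1" .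
  \<comment> \<open>The squared norms of the random vectors have mean 1 and
    \<open>eta 1 = 0\<close>, so by Jensen the normalisation term is nonpositive on average.
    Subtracting it can only help.\<close>
  have "(\<Sum>A\<in>Pow {..<m}. W * eta (\<Sum>a<d. (cmod (s A a))\<^sup>2))
      \<le> eta (\<Sum>A\<in>Pow {..<m}. W * (\<Sum>a<d. (cmod (s A a))\<^sup>2))"
    using W by (intro eta_jensen) (auto intro: sum_nonneg)
  also have "\<dots> = 0" using vector_decomposition_total[OF dec] by (simp add: d_def)
  finally have norms: "(\<Sum>A\<in>Pow {..<m}. W * eta (\<Sum>a<d. (cmod (s A a))\<^sup>2)) \<le> 0" .
  have "diagonal_entropy \<rho> - log 2 3
      = (\<Sum>a<d. eta (Re (\<rho> $$ (a, a))) - Re (\<rho> $$ (a, a)) * log 2 3)"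
    by (simp add: sum_subtractf sum_distrib_right[symmetric] tr diagonal_entropy_def d_def[symmetric])
  also have "\<dots> \<le> (\<Sum>a<d. \<Sum>A\<in>Pow {..<m}. W * eta ((cmod (s A a))\<^sup>2))"
    by (intro sum_mono ent) simp
  also have "\<dots> = (\<Sum>A\<in>Pow {..<m}. \<Sum>a<d. W * eta ((cmod (s A a))\<^sup>2))"
    by (rule sum.swap)
  also have "\<dots> \<le> (\<Sum>A\<in>Pow {..<m}. \<Sum>a<d. W * eta ((cmod (s A a))\<^sup>2))
      - (\<Sum>A\<in>Pow {..<m}. W * eta (\<Sum>a<d. (cmod (s A a))\<^sup>2))"
    using norms by simp
  also have "\<dots> = (\<Sum>A\<in>Pow {..<m}. W * ((\<Sum>a<d. eta ((cmod (s A a))\<^sup>2)) - eta (\<Sum>a<d. (cmod (s A a))\<^sup>2)))"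
    by (simp only: right_diff_distrib sum_subtractf sum_distrib_left)
  also have "\<dots> \<le> coherence_of_assistance \<rho>"
    using vector_decomposition_le_coherence[OF dec] by (simp only: d_def)
  finally show ?thesis .
qed

section \<open>Tensor powers and the regularisation\<close>

lemma sum_div_mod:
  fixes f :: "nat \<Rightarrow> nat \<Rightarrow> 'a :: comm_monoid_add"
  shows "(\<Sum>c<D * E. f (c div E) (c mod E)) = (\<Sum>i<D. \<Sum>j<E. f i j)"
proof -
  have "(\<Sum>i<D. \<Sum>j<E. f i j) = (\<Sum>(i, j)\<in>{..<D} \<times> {..<E}. f i j)"
    by (simp add: sum.cartesian_product)
  also have "\<dots> = (\<Sum>c<D * E. f (c div E) (c mod E))"
  proof (rule sum.reindex_bij_witness[where j = "\<lambda>(i, j). i * E + j" and i = "\<lambda>c. (c div E, c mod E)"])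
    fix c assume "c \<in> {..<D * E}"
    moreover from this have "0 < E" by (cases "E = 0") auto
    ultimately show "(c div E, c mod E) \<in> {..<D} \<times> {..<E}"
      by (simp add: less_mult_imp_div_less)
  next
    fix x assume x: "x \<in> {..<D} \<times> {..<E}"
    obtain i j where ij: "x = (i, j)" "i < D" "j < E" using x by auto
    have "i * E + j < Suc i * E" using ij by simp
    also have "\<dots> \<le> D * E" using ij by (intro mult_right_mono) auto
    finally show "(case x of (i, j) \<Rightarrow> i * E + j) \<in> {..<D * E}" by (simp add: ij)
  qed auto
  finally show ?thesis by simp
qed

lemma kronecker_index:
  assumes "\<rho> \<in> carrier_mat D D" "\<sigma> \<in> carrier_mat E E" "a < D * E" "b < D * E"
  shows "kronecker \<rho> \<sigma> $$ (a, b) = \<rho> $$ (a div E, b div E) * \<sigma> $$ (a mod E, b mod E)"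
  using assms by (simp add: kronecker_def)

lemma kronecker_carrier:
  assumes "\<rho> \<in> carrier_mat D D" "\<sigma> \<in> carrier_mat E E"
  shows "kronecker \<rho> \<sigma> \<in> carrier_mat (D * E) (D * E)"
  using assms by (simp add: kronecker_def)

lemma mat_trace_kronecker:
  assumes "\<rho> \<in> carrier_mat D D" "\<sigma> \<in> carrier_mat E E"
  shows "mat_trace (kronecker \<rho> \<sigma>) = mat_trace \<rho> * mat_trace \<sigma>"
proof -
  have "mat_trace (kronecker \<rho> \<sigma>)
      = (\<Sum>c<D * E. \<rho> $$ (c div E, c div E) * \<sigma> $$ (c mod E, c mod E))"
    using kronecker_carrier[OF assms]
    unfolding mat_trace_def by (intro sum.cong) (auto simp: kronecker_index[OF assms])
  also have "\<dots> = (\<Sum>i<D. \<Sum>j<E. \<rho> $$ (i, i) * \<sigma> $$ (j, j))"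
    by (rule sum_div_mod[where f = "\<lambda>i j. \<rho> $$ (i, i) * \<sigma> $$ (j, j)"])
  also have "\<dots> = mat_trace \<rho> * mat_trace \<sigma>"
    using assms by (simp add: mat_trace_def sum_product)
  finally show ?thesis .
qed

lemma vector_decomposition_kronecker:
  assumes "vector_decomposition \<rho> K w y" "vector_decomposition \<sigma> L v z"
  shows "vector_decomposition (kronecker \<rho> \<sigma>) (K \<times> L) (\<lambda>(k, l). w k * v l)
    (\<lambda>(k, l) c. y k (c div dim_row \<sigma>) * z l (c mod dim_row \<sigma>))"
proof -
  define D E where "D = dim_row \<rho>" and "E = dim_row \<sigma>"
  have c: "\<rho> \<in> carrier_mat D D" "\<sigma> \<in> carrier_mat E E"
    and tr: "mat_trace \<rho> = 1" "mat_trace \<sigma> = 1"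
    and KL: "finite K" "finite L" "\<And>k. k \<in> K \<Longrightarrow> 0 \<le> w k" "\<And>l. l \<in> L \<Longrightarrow> 0 \<le> v l"
    and r: "\<And>a b. a < D \<Longrightarrow> b < D \<Longrightarrow> \<rho> $$ (a, b) = (\<Sum>k\<in>K. of_real (w k) * y k a * cnj (y k b))"
    and s: "\<And>a b. a < E \<Longrightarrow> b < E \<Longrightarrow> \<sigma> $$ (a, b) = (\<Sum>l\<in>L. of_real (v l) * z l a * cnj (z l b))"
    using assms by (simp_all add: vector_decomposition_def D_def E_def)
  have "kronecker \<rho> \<sigma> $$ (a, b) = (\<Sum>x\<in>K \<times> L. of_real (case x of (k, l) \<Rightarrow> w k * v l) *
      (case x of (k, l) \<Rightarrow> \<lambda>c. y k (c div E) * z l (c mod E)) a *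
      cnj ((case x of (k, l) \<Rightarrow> \<lambda>c. y k (c div E) * z l (c mod E)) b))"
    if ab: "a < D * E" "b < D * E" for a b
  proof -
    have E: "0 < E" using ab by (cases "E = 0") auto
    have "a div E < D" "b div E < D" "a mod E < E" "b mod E < E"
      using ab E by (simp_all add: less_mult_imp_div_less)
    then have "kronecker \<rho> \<sigma> $$ (a, b)
       = (\<Sum>k\<in>K. of_real (w k) * y k (a div E) * cnj (y k (b div E))) *
         (\<Sum>l\<in>L. of_real (v l) * z l (a mod E) * cnj (z l (b mod E)))"
      by (simp add: kronecker_index[OF c ab] r s)
    also have "\<dots> = (\<Sum>k\<in>K. \<Sum>l\<in>L. (of_real (w k) * y k (a div E) * cnj (y k (b div E))) *
        (of_real (v l) * z l (a mod E) * cnj (z l (b mod E))))"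
      by (rule sum_product)
    also have "\<dots> = (\<Sum>x\<in>K \<times> L. of_real (case x of (k, l) \<Rightarrow> w k * v l) *
      (case x of (k, l) \<Rightarrow> \<lambda>c. y k (c div E) * z l (c mod E)) a *
      cnj ((case x of (k, l) \<Rightarrow> \<lambda>c. y k (c div E) * z l (c mod E)) b))"
      by (subst sum.cartesian_product) (intro sum.cong, auto simp: mult_ac)
    finally show ?thesis .
  qed
  moreover have "dim_row (kronecker \<rho> \<sigma>) = D * E" "kronecker \<rho> \<sigma> \<in> carrier_mat (D * E) (D * E)"
    using kronecker_carrier[OF c] by (simp_all only: carrier_matD)
  moreover have "mat_trace (kronecker \<rho> \<sigma>) = 1"
    using mat_trace_kronecker[OF c] tr by simp
  moreover have "\<forall>x\<in>K \<times> L. 0 \<le> (case x of (k, l) \<Rightarrow> w k * v l)" "finite (K \<times> L)"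
    using KL by auto
  ultimately show ?thesis
    unfolding vector_decomposition_def E_def[symmetric] by simp
qed

lemma vector_decomposition_diag_nonneg:
  assumes "vector_decomposition \<rho> K w y" "a < dim_row \<rho>"
  shows "\<rho> $$ (a, a) = of_real (Re (\<rho> $$ (a, a)))" and "0 \<le> Re (\<rho> $$ (a, a))"
proof -
  have w: "\<forall>k\<in>K. 0 \<le> w k" using assms(1) by (simp add: vector_decomposition_def)
  have "0 \<le> (\<Sum>k\<in>K. w k * (cmod (y k a))\<^sup>2)"
    using w by (intro sum_nonneg) simp
  then show "\<rho> $$ (a, a) = of_real (Re (\<rho> $$ (a, a)))" "0 \<le> Re (\<rho> $$ (a, a))"
    unfolding vector_decomposition_diag[OF assms] by (simp_all only: Re_complex_of_real)
qed

lemma diagonal_entropy_kronecker: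
  assumes "vector_decomposition \<rho> K w y" "vector_decomposition \<sigma> L v z"
  shows "diagonal_entropy (kronecker \<rho> \<sigma>) = diagonal_entropy \<rho> + diagonal_entropy \<sigma>"
proof -
  define D E where "D = dim_row \<rho>" and "E = dim_row \<sigma>"
  have c: "\<rho> \<in> carrier_mat D D" "\<sigma> \<in> carrier_mat E E"
    and tr: "mat_trace \<rho> = 1" "mat_trace \<sigma> = 1"
    using assms by (simp_all add: vector_decomposition_def D_def E_def)
  define p q where "p i = Re (\<rho> $$ (i, i))" and "q i = Re (\<sigma> $$ (i, i))" for i
  have "(\<Sum>i<D. p i) = Re (mat_trace \<rho>)" "(\<Sum>i<E. q i) = Re (mat_trace \<sigma>)"
    by (simp_all add: mat_trace_def D_def E_def p_def q_def)
  then have pq1: "(\<Sum>i<D. p i) = 1" "(\<Sum>i<E. q i) = 1" using tr by simp_all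
  have p: "\<rho> $$ (i, i) = of_real (p i)" "0 \<le> p i" if "i < D" for i
    using vector_decomposition_diag_nonneg[OF assms(1)] that by (simp_all add: p_def D_def)
  have q: "\<sigma> $$ (i, i) = of_real (q i)" "0 \<le> q i" if "i < E" for i
    using vector_decomposition_diag_nonneg[OF assms(2)] that by (simp_all add: q_def E_def)
  have "diagonal_entropy (kronecker \<rho> \<sigma>)
      = (\<Sum>c<D * E. eta (Re (\<rho> $$ (c div E, c div E) * \<sigma> $$ (c mod E, c mod E))))"
    using kronecker_carrier[OF c] unfolding diagonal_entropy_def
    by (intro sum.cong) (auto simp: kronecker_index[OF c])
  also have "\<dots> = (\<Sum>i<D. \<Sum>j<E. eta (Re (\<rho> $$ (i, i) * \<sigma> $$ (j, j))))"
    by (rule sum_div_mod[where f = "\<lambda>i j. eta (Re (\<rho> $$ (i, i) * \<sigma> $$ (j, j)))"])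
  also have "\<dots> = (\<Sum>i<D. \<Sum>j<E. p i * eta (q j) + q j * eta (p i))"
    by (intro sum.cong refl) (simp add: p q eta_mult)
  also have "\<dots> = (\<Sum>i<D. p i * (\<Sum>j<E. eta (q j)) + (\<Sum>j<E. q j) * eta (p i))"
    by (simp add: sum.distrib sum_distrib_left sum_distrib_right)
  also have "\<dots> = (\<Sum>j<E. eta (q j)) + (\<Sum>i<D. eta (p i))"
    by (simp add: sum.distrib sum_distrib_right[symmetric] pq1)
  finally show ?thesis
    by (simp add: diagonal_entropy_def D_def E_def p_def q_def)
qed

text \<open>Both claims share one induction: additivity of the diagonal entropy rests on trace one
  and a nonnegative diagonal, which are read off from the decompositions.\<close>

lemma tensor_power_decomposition:
  assumes "pure_state_decomposition \<rho> m p \<psi>"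
  shows "(\<exists>m' p' \<psi>'. pure_state_decomposition (tensor_power \<rho> n) m' p' \<psi>') \<and>
    diagonal_entropy (tensor_power \<rho> n) = real n * diagonal_entropy \<rho>"
proof (induction n)
  case 0
  have "vector_decomposition (1\<^sub>m 1) {()} (\<lambda>_. 1) (\<lambda>_ _. 1)"
    by (simp add: vector_decomposition_def mat_trace_def)
  then show ?case
    using vector_imp_pure_state_decomposition by (fastforce simp: diagonal_entropy_def)
next
  case (Suc n)
  then obtain m' p' \<psi>' where IH: "pure_state_decomposition (tensor_power \<rho> n) m' p' \<psi>'"
    and ent: "diagonal_entropy (tensor_power \<rho> n) = real n * diagonal_entropy \<rho>"
    by blast
  note dec = assms[THEN pure_state_imp_vector_decomposition] IH[THEN pure_state_imp_vector_decomposition]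
  have "diagonal_entropy (tensor_power \<rho> (Suc n)) = real (Suc n) * diagonal_entropy \<rho>"
    using diagonal_entropy_kronecker[OF dec] by (simp add: ent algebra_simps)
  then show ?case
    using vector_imp_pure_state_decomposition[OF vector_decomposition_kronecker[OF dec]]
    by auto
qed

text \<open>The error \<open>log 2 3\<close> stays fixed while the dimension of the tensor power
  grows, so division by n removes it.\<close>

lemma regularized_coherence:
  assumes "pure_state_decomposition \<rho> m p \<psi>"
  shows "regularized_coherence_of_assistance \<rho> = diagonal_entropy \<rho>"
proof -
  let ?c = "\<lambda>n. coherence_of_assistance (tensor_power \<rho> n) / real n"
  have bounds: "diagonal_entropy \<rho> - log 2 3 / real n \<le> ?c n \<and> ?c n \<le> diagonal_entropy \<rho>"
    if "0 < n" for n
  proof -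
    obtain m' p' \<psi>' where dec: "pure_state_decomposition (tensor_power \<rho> n) m' p' \<psi>'"
      and ent: "diagonal_entropy (tensor_power \<rho> n) = real n * diagonal_entropy \<rho>"
      using tensor_power_decomposition[OF assms] by blast
    have "(real n * diagonal_entropy \<rho> - log 2 3) / real n \<le> ?c n"
      using coherence_ge[OF dec] by (simp add: ent divide_right_mono)
    moreover have "?c n \<le> real n * diagonal_entropy \<rho> / real n"
      using coherence_le_diagonal_entropy[OF pure_state_imp_vector_decomposition[OF dec]]
      unfolding ent by (rule divide_right_mono) simp
    ultimately show ?thesis using that by (simp add: diff_divide_distrib)
  qed
  have "?c \<longlonglongrightarrow> diagonal_entropy \<rho>"
  proof (rule tendsto_sandwich)
    show "\<forall>\<^sub>F n in sequentially. diagonal_entropy \<rho> - log 2 3 / real n \<le> ?c n"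
      "\<forall>\<^sub>F n in sequentially. ?c n \<le> diagonal_entropy \<rho>"
      using bounds by (auto intro: eventually_mono[OF eventually_gt_at_top[of 0]])
    show "(\<lambda>n. diagonal_entropy \<rho> - log 2 3 / real n) \<longlonglongrightarrow> diagonal_entropy \<rho>"
      using tendsto_diff[OF tendsto_const lim_const_over_n] by fastforce
  qed simp
  then show ?thesis
    unfolding regularized_coherence_of_assistance_def by (rule limI)
qed

section \<open>A rank two state in dimension at least four\<close>

text \<open>As a sum of squares the form is visibly nonnegative, and it vanishes only if the
  functional \<open>c\<close> kills every member of positive weight. The left side depends on the
  matrix alone, which lets two decompositions be compared.\<close>

lemma vector_decomposition_functional:
  assumes "vector_decomposition \<rho> K w y"
  shows "(\<Sum>a<dim_row \<rho>. \<Sum>b<dim_row \<rho>. c a * \<rho> $$ (a, b) * cnj (c b))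
    = of_real (\<Sum>k\<in>K. w k * (cmod (\<Sum>a<dim_row \<rho>. c a * y k a))\<^sup>2)"
proof -
  define d where "d = dim_row \<rho>"
  have "(\<Sum>a<d. \<Sum>b<d. c a * \<rho> $$ (a, b) * cnj (c b))
      = (\<Sum>a<d. \<Sum>b<d. \<Sum>k\<in>K. of_real (w k) * ((c a * y k a) * cnj (c b * y k b)))"
    using assms by (intro sum.cong refl)
      (simp add: vector_decomposition_def d_def sum_distrib_left sum_distrib_right mult_ac)
  also have "\<dots> = (\<Sum>k\<in>K. \<Sum>a<d. \<Sum>b<d. of_real (w k) * ((c a * y k a) * cnj (c b * y k b)))"
    by (subst sum.swap[of _ "{..<d}" K], subst sum.swap[of _ "{..<d}" K], rule refl)
  also have "\<dots> = (\<Sum>k\<in>K. of_real (w k) * ((\<Sum>a<d. c a * y k a) * cnj (\<Sum>b<d. c b * y k b)))"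
    by (simp only: sum_product cnj_sum) (simp only: sum_distrib_left)
  also have "\<dots> = of_real (\<Sum>k\<in>K. w k * (cmod (\<Sum>a<d. c a * y k a))\<^sup>2)"
    by (simp add: mult_cnj_cmod del: cnj_sum complex_cnj_mult)
  finally show ?thesis by (simp only: d_def)
qed

text \<open>The range of \<open>\<rho>\<close> is spanned by the vectors of any decomposition.\<close>

lemma vector_decomposition_annihilator:
  assumes y: "vector_decomposition \<rho> K w y" and z: "vector_decomposition \<rho> L v z"
    and c: "\<And>k. k \<in> K \<Longrightarrow> (\<Sum>a<dim_row \<rho>. c a * y k a) = 0"
    and l: "l \<in> L" "v l \<noteq> 0"
  shows "(\<Sum>a<dim_row \<rho>. c a * z l a) = 0"
proof -
  have "complex_of_real (\<Sum>l\<in>L. v l * (cmod (\<Sum>a<dim_row \<rho>. c a * z l a))\<^sup>2)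
      = of_real (\<Sum>k\<in>K. w k * (cmod (\<Sum>a<dim_row \<rho>. c a * y k a))\<^sup>2)"
    by (simp only: vector_decomposition_functional[OF y, symmetric]
        vector_decomposition_functional[OF z, symmetric])
  also have "(\<Sum>k\<in>K. w k * (cmod (\<Sum>a<dim_row \<rho>. c a * y k a))\<^sup>2) = 0"
    using c by (intro sum.neutral) simp
  finally have "(\<Sum>l\<in>L. v l * (cmod (\<Sum>a<dim_row \<rho>. c a * z l a))\<^sup>2) = 0"
    by (simp only: of_real_eq_iff)
  moreover have "finite L" "\<forall>l\<in>L. 0 \<le> v l"
    using z by (simp_all add: vector_decomposition_def)
  ultimately have "\<forall>l\<in>L. v l * (cmod (\<Sum>a<dim_row \<rho>. c a * z l a))\<^sup>2 = 0"
    by (subst sum_nonneg_eq_0_iff[symmetric]) auto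
  then show ?thesis using l by auto
qed

lemma vector_decomposition_imp_density:
  assumes "vector_decomposition \<rho> K w y"
  shows "density_matrix (dim_row \<rho>) \<rho>"
proof -
  define d where "d = dim_row \<rho>"
  have c: "\<rho> \<in> carrier_mat d d" and w: "\<forall>k\<in>K. 0 \<le> w k" and tr: "mat_trace \<rho> = 1"
    using assms by (simp_all add: vector_decomposition_def d_def)
  have "0 \<le> (\<rho> *\<^sub>v v) \<bullet>c v" if "v \<in> carrier_vec d" for v
  proof -
    have "(\<rho> *\<^sub>v v) \<bullet>c v = (\<Sum>a<d. \<Sum>b<d. cnj (v $ a) * \<rho> $$ (a, b) * cnj (cnj (v $ b)))"
      using that c
      by (simp add: scalar_prod_def atLeast0LessThan sum_distrib_left sum_distrib_right mult_ac)
    also have "\<dots> = of_real (\<Sum>k\<in>K. w k * (cmod (\<Sum>a<d. cnj (v $ a) * y k a))\<^sup>2)"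
      unfolding d_def by (rule vector_decomposition_functional[OF assms])
    finally have "(\<rho> *\<^sub>v v) \<bullet>c v = of_real (\<Sum>k\<in>K. w k * (cmod (\<Sum>a<d. cnj (v $ a) * y k a))\<^sup>2)" .
    moreover have "0 \<le> (\<Sum>k\<in>K. w k * (cmod (\<Sum>a<d. cnj (v $ a) * y k a))\<^sup>2)"
      using w by (intro sum_nonneg) simp
    ultimately show ?thesis
      by (simp only: less_eq_complex_def Re_complex_of_real Im_complex_of_real zero_complex.sel)
  qed
  then show ?thesis
    unfolding density_matrix_def d_def[symmetric] using c tr by simp
qed

text \<open>
  The columns \<open>y 0\<close>, \<open>y 1\<close> below span a plane containing no vector whose four first entries all have
  modulus \<open>1 / 2\<close>: such a vector \<open>\<alpha> y\<^sub>0 + \<beta> y\<^sub>1\<close> would need \<open>\<bar>\<alpha>\<bar> = \<bar>\<beta>\<bar> = 1\<close> and, from the entries 2 and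
  3, both the real and the imaginary part of \<open>\<alpha> cnj \<beta>\<close> to vanish.
\<close>

definition plane_vectors :: "nat \<Rightarrow> nat \<Rightarrow> complex" where
  "plane_vectors k a =
    (if k = 0 then (if a = 0 then 1 / 2 else if a = 2 \<or> a = 3 then 3 / 10 else 0)
     else (if a = 1 then 1 / 2 else if a = 2 then 2 / 5 else if a = 3 then 2 / 5 * \<i> else 0))"

text \<open>The triple 3, 4, 5 gives (3/10)^2 + (2/5)^2 = 1/4, which keeps the columns rational up
  to the factor \<open>\<i>\<close> while the first four diagonal entries are all 1/4.\<close>

definition plane_state :: "nat \<Rightarrow> complex mat" where
  "plane_state d = mat d d (\<lambda>(a, b). \<Sum>k<2. plane_vectors k a * cnj (plane_vectors k b))"

lemma sum_lessThan_4:
  fixes f :: "nat \<Rightarrow> 'a :: comm_monoid_add"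
  assumes "4 \<le> d" "\<And>a. 4 \<le> a \<Longrightarrow> a < d \<Longrightarrow> f a = 0"
  shows "(\<Sum>a<d. f a) = f 0 + f 1 + f 2 + f 3"
proof -
  have "(\<Sum>a<d. f a) = (\<Sum>a<4. f a)"
    using assms by (intro sum.mono_neutral_right) auto
  then show ?thesis by (simp add: eval_nat_numeral)
qed

lemma plane_state_decomposition:
  assumes "4 \<le> d"
  shows "vector_decomposition (plane_state d) {..<2} (\<lambda>_. 1) plane_vectors"
proof -
  have "mat_trace (plane_state d) = (\<Sum>a<d. \<Sum>k<2. plane_vectors k a * cnj (plane_vectors k a))"
    by (simp add: mat_trace_def plane_state_def)
  also have "\<dots> = 1"
    by (subst sum_lessThan_4[OF assms]) (simp_all add: plane_vectors_def eval_nat_numeral)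
  finally show ?thesis
    by (simp add: vector_decomposition_def plane_state_def)
qed

lemma diagonal_entropy_plane_state:
  assumes "4 \<le> d"
  shows "diagonal_entropy (plane_state d) = 2"
proof -
  have "log 2 (1 / 4 :: real) = - 2"
    using log_pow_cancel[of 2 2] by (simp add: log_divide)
  then have "eta (1 / 4) = 1 / 2" by (simp add: eta_def)
  moreover have "diagonal_entropy (plane_state d)
      = (\<Sum>a<d. eta (Re (\<Sum>k<2. plane_vectors k a * cnj (plane_vectors k a))))"
    by (simp add: diagonal_entropy_def plane_state_def)
  moreover have "\<dots> = 4 * eta (1 / 4)"
    by (subst sum_lessThan_4[OF assms]) (simp_all add: plane_vectors_def eval_nat_numeral)
  ultimately show ?thesis by simp
qed

text \<open>These are linear equations of the plane, obtained from functionals that vanish on both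
  columns. Only members of nonzero weight are forced to lie in it.\<close>

lemma plane_vector_relations:
  assumes d: "4 \<le> d" and dec: "pure_state_decomposition (plane_state d) m p \<psi>"
    and i: "i < m" "p i \<noteq> 0"
  shows "5 * \<psi> i $ 2 = 3 * \<psi> i $ 0 + 4 * \<psi> i $ 1"
    and "5 * \<psi> i $ 3 = 3 * \<psi> i $ 0 + 4 * \<i> * \<psi> i $ 1"
    and "\<And>a. 4 \<le> a \<Longrightarrow> a < d \<Longrightarrow> \<psi> i $ a = 0"
proof -
  have dim: "dim_row (plane_state d) = d" by (simp add: plane_state_def)
  have ann: "(\<Sum>a<d. c a * \<psi> i $ a) = 0"
    if "\<And>k. k < 2 \<Longrightarrow> (\<Sum>a<d. c a * plane_vectors k a) = 0" for c
    using vector_decomposition_annihilator[OF plane_state_decomposition[OF d]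
        pure_state_imp_vector_decomposition[OF dec], of c i] that i
    by (simp add: dim)
  have "(\<Sum>a<d. (if a = 0 then 3 else if a = 1 then 4 else if a = 2 then - 5 else 0) * \<psi> i $ a) = 0"
    by (rule ann, subst sum_lessThan_4[OF d]) (auto simp: plane_vectors_def)
  then show "5 * \<psi> i $ 2 = 3 * \<psi> i $ 0 + 4 * \<psi> i $ 1"
    by (subst (asm) sum_lessThan_4[OF d]) (auto simp: algebra_simps)
  have "(\<Sum>a<d. (if a = 0 then 3 else if a = 1 then 4 * \<i> else if a = 3 then - 5 else 0) * \<psi> i $ a) = 0"
    by (rule ann, subst sum_lessThan_4[OF d]) (auto simp: plane_vectors_def)
  then show "5 * \<psi> i $ 3 = 3 * \<psi> i $ 0 + 4 * \<i> * \<psi> i $ 1"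
    by (subst (asm) sum_lessThan_4[OF d]) (auto simp: algebra_simps)
  show "\<psi> i $ b = 0" if b: "4 \<le> b" "b < d" for b
  proof -
    have "(\<Sum>a<d. (if a = b then 1 else 0) * \<psi> i $ a) = 0"
      using b by (intro ann) (auto simp: plane_vectors_def intro!: sum.neutral)
    moreover have "(\<Sum>a<d. (if a = b then 1 else 0) * \<psi> i $ a) = (\<Sum>a<d. if a = b then \<psi> i $ a else 0)"
      by (intro sum.cong) auto
    ultimately show ?thesis using b by simp
  qed
qed

text \<open>Since 25 = 9 + 16, deviations of at most 1/20 force |24 R| and |24 I| to be at most
  50/20, hence |R| and |I| below 1/8. Then R^2 + I^2 <= 1/32, whereas it equals the product of the
  first two squared moduli, at least (1/5)^2 = 1/25.\<close>

lemma plane_vector_not_uniform: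
  fixes \<alpha> \<beta> \<gamma> \<delta> :: complex
  assumes "5 * \<gamma> = 3 * \<alpha> + 4 * \<beta>" "5 * \<delta> = 3 * \<alpha> + 4 * \<i> * \<beta>"
  shows "\<exists>x\<in>{(cmod \<alpha>)\<^sup>2, (cmod \<beta>)\<^sup>2, (cmod \<gamma>)\<^sup>2, (cmod \<delta>)\<^sup>2}. 1 / 20 < \<bar>x - 1 / 4\<bar>"
proof (rule ccontr)
  assume "\<not> ?thesis"
  then have close: "\<bar>(cmod \<alpha>)\<^sup>2 - 1 / 4\<bar> \<le> 1 / 20" "\<bar>(cmod \<beta>)\<^sup>2 - 1 / 4\<bar> \<le> 1 / 20"
    "\<bar>(cmod \<gamma>)\<^sup>2 - 1 / 4\<bar> \<le> 1 / 20" "\<bar>(cmod \<delta>)\<^sup>2 - 1 / 4\<bar> \<le> 1 / 20"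
    by auto
  define R I where "R = Re (\<alpha> * cnj \<beta>)" and "I = Im (\<alpha> * cnj \<beta>)"
  have "25 * (cmod \<gamma>)\<^sup>2 = (cmod (5 * \<gamma>))\<^sup>2" by (simp add: norm_mult power_mult_distrib)
  also have "\<dots> = 9 * (cmod \<alpha>)\<^sup>2 + 16 * (cmod \<beta>)\<^sup>2 + 24 * R"
    unfolding assms R_def cmod_power2 by (simp add: power2_eq_square algebra_simps)
  finally have R: "25 * (cmod \<gamma>)\<^sup>2 = 9 * (cmod \<alpha>)\<^sup>2 + 16 * (cmod \<beta>)\<^sup>2 + 24 * R" .
  have "25 * (cmod \<delta>)\<^sup>2 = (cmod (5 * \<delta>))\<^sup>2" by (simp add: norm_mult power_mult_distrib)
  also have "\<dots> = 9 * (cmod \<alpha>)\<^sup>2 + 16 * (cmod \<beta>)\<^sup>2 + 24 * I"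
    unfolding assms I_def cmod_power2 by (simp add: power2_eq_square algebra_simps)
  finally have I: "25 * (cmod \<delta>)\<^sup>2 = 9 * (cmod \<alpha>)\<^sup>2 + 16 * (cmod \<beta>)\<^sup>2 + 24 * I" .
  have "\<bar>R\<bar> \<le> 1 / 8" "\<bar>I\<bar> \<le> 1 / 8"
    using R I close unfolding abs_le_iff by linarith+
  then have "R\<^sup>2 \<le> (1 / 8)\<^sup>2" "I\<^sup>2 \<le> (1 / 8)\<^sup>2"
    by (simp_all add: abs_le_square_iff[symmetric])
  moreover have "R\<^sup>2 + I\<^sup>2 = (cmod \<alpha>)\<^sup>2 * (cmod \<beta>)\<^sup>2"
    using cmod_power2[of "\<alpha> * cnj \<beta>"] by (simp add: R_def I_def norm_mult power_mult_distrib)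
  moreover have "1 / 5 * (1 / 5) \<le> (cmod \<alpha>)\<^sup>2 * (cmod \<beta>)\<^sup>2"
    using close unfolding abs_le_iff by (intro mult_mono) auto
  ultimately show False by (simp add: power2_eq_square)
qed

text \<open>The tangent of \<open>eta\<close> at 1/4, improved by a squared Hellinger term. The gain
  comes from applying \<open>ln t <= t - 1\<close> to the square root of 1 / (4 x) instead of to 1 /
  (4 x) itself.\<close>

lemma eta_le_hellinger:
  assumes "0 \<le> x"
  shows "eta x \<le> 2 * x - ((x - 1 / 4) + (sqrt x - 1 / 2)\<^sup>2) / ln 2"
proof (cases "x = 0")
  case True
  then show ?thesis by (simp add: power2_eq_square)
next
  case False
  then have x: "0 < x" using assms by simp
  have "ln (1 / (2 * sqrt x)) \<le> 1 / (2 * sqrt x) - 1"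
    using x by (intro ln_le_minus_one) simp
  moreover have "ln (1 / (2 * sqrt x)) = - ln 2 - ln x / 2"
    using x by (simp add: ln_div ln_mult ln_sqrt)
  ultimately have "2 * x * (- ln 2 - ln x / 2) \<le> 2 * x * (1 / (2 * sqrt x) - 1)"
    using x by (intro mult_left_mono) auto
  also have "\<dots> = sqrt x - 2 * x"
    using x by (simp add: right_diff_distrib real_div_sqrt)
  also have "\<dots> = - ((x - 1 / 4) + (sqrt x - 1 / 2)\<^sup>2)"
    using x by (simp add: power2_diff power_divide)
  finally have "(- x * ln x - 2 * x * ln 2) / ln 2 \<le> - ((x - 1 / 4) + (sqrt x - 1 / 2)\<^sup>2) / ln 2"
    by (intro divide_right_mono) (auto simp: algebra_simps)
  then show ?thesis
    by (simp add: eta_def log_def diff_divide_distrib add_divide_distrib)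
qed

lemma hellinger_ge:
  assumes "0 \<le> x" "x \<le> 1" "1 / 20 < \<bar>x - 1 / 4\<bar>"
  shows "1 / 900 \<le> (sqrt x - 1 / 2)\<^sup>2"
proof -
  have "x - 1 / 4 = (sqrt x - 1 / 2) * (sqrt x + 1 / 2)"
    using assms by (simp add: algebra_simps)
  then have "\<bar>x - 1 / 4\<bar> = \<bar>sqrt x - 1 / 2\<bar> * (sqrt x + 1 / 2)"
    using assms by (simp add: abs_mult)
  \<comment> \<open>Here \<open>sqrt x + 1 / 2\<close> is at most 3/2, so a deviation 1/20 of x
    costs at least 1/30 in the root; its square is 1/900.\<close>
  also have "\<dots> \<le> \<bar>sqrt x - 1 / 2\<bar> * (3 / 2)"
    using assms by (intro mult_left_mono) auto
  finally have "1 / 30 \<le> \<bar>sqrt x - 1 / 2\<bar>" using assms by simp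
  then have "(1 / 30)\<^sup>2 \<le> (sqrt x - 1 / 2)\<^sup>2"
    by (simp add: abs_le_square_iff[symmetric])
  then show ?thesis by (simp add: power2_eq_square)
qed

text \<open>The linear parts of the four bounds depend only on the total probability and add up to
  2, so the Hellinger terms are a net deficit; one of them is at least 1/900.\<close>

lemma entropy_four_outcomes:
  fixes x0 x1 x2 x3 :: real
  assumes "0 \<le> x0" "0 \<le> x1" "0 \<le> x2" "0 \<le> x3" "x0 + x1 + x2 + x3 = 1"
    and "\<exists>x\<in>{x0, x1, x2, x3}. 1 / 20 < \<bar>x - 1 / 4\<bar>"
  shows "eta x0 + eta x1 + eta x2 + eta x3 \<le> 2 - 1 / (900 * ln 2)"
proof -
  define g where "g x = (sqrt x - 1 / 2)\<^sup>2" for x :: real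
  have g: "0 \<le> g x" for x by (simp add: g_def)
  obtain x where x: "x \<in> {x0, x1, x2, x3}" "1 / 20 < \<bar>x - 1 / 4\<bar>" using assms by blast
  have "0 \<le> x" "x \<le> 1" using x assms by auto
  then have "1 / 900 \<le> g x" unfolding g_def using x by (intro hellinger_ge) auto
  also have "g x \<le> g x0 + g x1 + g x2 + g x3"
    using x(1) g[of x0] g[of x1] g[of x2] g[of x3] by auto
  finally have "1 / 900 / ln 2 \<le> (g x0 + g x1 + g x2 + g x3) / ln 2"
    by (intro divide_right_mono) auto
  moreover have "eta x0 + eta x1 + eta x2 + eta x3
      \<le> (2 * x0 - ((x0 - 1 / 4) + g x0) / ln 2) + (2 * x1 - ((x1 - 1 / 4) + g x1) / ln 2)
        + (2 * x2 - ((x2 - 1 / 4) + g x2) / ln 2) + (2 * x3 - ((x3 - 1 / 4) + g x3) / ln 2)"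
    unfolding g_def using assms by (intro add_mono eta_le_hellinger)
  moreover have "\<dots> = 2 * (x0 + x1 + x2 + x3)
      - ((x0 + x1 + x2 + x3) - 1 + (g x0 + g x1 + g x2 + g x3)) / ln 2"
    by (simp add: diff_divide_distrib add_divide_distrib)
  ultimately show ?thesis using assms(5) by simp
qed

lemma coherence_plane_state:
  assumes d: "4 \<le> d"
  shows "coherence_of_assistance (plane_state d) \<le> 2 - 1 / (900 * ln 2)"
  unfolding coherence_of_assistance_def
proof (rule cSup_least)
  obtain m p \<psi> where "pure_state_decomposition (plane_state d) m p \<psi>"
    using vector_imp_pure_state_decomposition[OF plane_state_decomposition[OF d]] by (elim exE conjE)
  then show "{(\<Sum>i<m. p i * von_neumann_entropy (dephase (ket_bra (\<psi> i)))) | m p \<psi>.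
      pure_state_decomposition (plane_state d) m p \<psi>} \<noteq> {}"
    by blast
next
  fix e
  assume "e \<in> {(\<Sum>i<m. p i * von_neumann_entropy (dephase (ket_bra (\<psi> i)))) | m p \<psi>.
      pure_state_decomposition (plane_state d) m p \<psi>}"
  then obtain m p \<psi> where
    e: "e = (\<Sum>i<m. p i * von_neumann_entropy (dephase (ket_bra (\<psi> i))))"
    and dec: "pure_state_decomposition (plane_state d) m p \<psi>"
    by blast
  have p: "\<And>i. i < m \<Longrightarrow> 0 \<le> p i" "(\<Sum>i<m. p i) = 1"
    and u: "\<And>i. i < m \<Longrightarrow> unit_vector d (\<psi> i)"
    using dec by (auto simp: pure_state_decomposition_def plane_state_def)
  have "p i * von_neumann_entropy (dephase (ket_bra (\<psi> i))) \<le> p i * (2 - 1 / (900 * ln 2))"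
    if i: "i < m" for i
  \<comment> \<open>A member of weight zero need not lie in the plane, but it contributes
    nothing.\<close>
  proof (cases "p i = 0")
    case False
    note rel = plane_vector_relations[OF d dec i False]
    have unit: "(\<Sum>a<d. (cmod (\<psi> i $ a))\<^sup>2) = 1" and dim: "dim_vec (\<psi> i) = d"
      using u[OF i] by (auto simp: unit_vector_iff)
    have "(cmod (\<psi> i $ 0))\<^sup>2 + (cmod (\<psi> i $ 1))\<^sup>2 + (cmod (\<psi> i $ 2))\<^sup>2 + (cmod (\<psi> i $ 3))\<^sup>2 = 1"
      using unit rel(3) by (subst (asm) sum_lessThan_4[OF d]) auto
    then have "eta ((cmod (\<psi> i $ 0))\<^sup>2) + eta ((cmod (\<psi> i $ 1))\<^sup>2) + eta ((cmod (\<psi> i $ 2))\<^sup>2)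
        + eta ((cmod (\<psi> i $ 3))\<^sup>2) \<le> 2 - 1 / (900 * ln 2)"
      by (intro entropy_four_outcomes plane_vector_not_uniform rel) simp_all
    also have "eta ((cmod (\<psi> i $ 0))\<^sup>2) + eta ((cmod (\<psi> i $ 1))\<^sup>2) + eta ((cmod (\<psi> i $ 2))\<^sup>2)
        + eta ((cmod (\<psi> i $ 3))\<^sup>2) = von_neumann_entropy (dephase (ket_bra (\<psi> i)))"
      unfolding von_neumann_entropy_ket_bra dim using rel(3)
      by (subst sum_lessThan_4[OF d]) auto
    finally show ?thesis using p(1)[OF i] by (rule mult_left_mono)
  qed simp
  then have "e \<le> (\<Sum>i<m. p i * (2 - 1 / (900 * ln 2)))"
    unfolding e by (intro sum_mono) simp
  also have "\<dots> = 2 - 1 / (900 * ln 2)" by (simp add: sum_distrib_right[symmetric] p(2))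
  finally show "e \<le> 2 - 1 / (900 * ln 2)" .
qed

lemma strict_gap_dimension_four:
  assumes "4 \<le> d"
  shows "\<exists>\<rho>. density_matrix d \<rho> \<and> coherence_of_assistance \<rho> < regularized_coherence_of_assistance \<rho>"
proof (intro exI conjI)
  show "density_matrix d (plane_state d)"
    using vector_decomposition_imp_density[OF plane_state_decomposition[OF assms]]
    by (simp add: plane_state_def)
  obtain m p \<psi> where "pure_state_decomposition (plane_state d) m p \<psi>"
    using vector_imp_pure_state_decomposition[OF plane_state_decomposition[OF assms]]
    by (elim exE conjE)
  then have "regularized_coherence_of_assistance (plane_state d) = 2"
    using regularized_coherence diagonal_entropy_plane_state[OF assms] by metis
  moreover have "0 < 1 / (900 * ln 2 :: real)" by simp
  ultimately show "coherence_of_assistance (plane_state d)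
      < regularized_coherence_of_assistance (plane_state d)"
    using coherence_plane_state[OF assms] by linarith
qed

section \<open>Correlation matrices of size three\<close>

text \<open>Rotating by the phase of \<gamma> makes the level lines of Re (\<gamma> * w) vertical.
  The vertical chord through the rotated point ends on the unit circle at a + ih and a - ih.\<close>

lemma unit_disc_chord:
  assumes "cmod x \<le> 1"
  obtains t \<phi> \<phi>' where "0 \<le> t" "t \<le> 1" "cmod \<phi> = 1" "cmod \<phi>' = 1"
    "x = of_real t * \<phi> + of_real (1 - t) * \<phi>'"
    "Re (\<gamma> * \<phi>) = Re (\<gamma> * x)" "Re (\<gamma> * \<phi>') = Re (\<gamma> * x)"
proof -
  define u where "u = (if \<gamma> = 0 then 1 else sgn \<gamma>)"
  have u: "cmod u = 1" "\<gamma> = of_real (cmod \<gamma>) * u"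
    by (simp_all add: u_def norm_sgn) (simp add: sgn_eq)
  have uu: "u * cnj u = 1" using u(1) by (simp add: mult_cnj_cmod)
  define a b where "a = Re (u * x)" and "b = Im (u * x)"
  have ux: "u * x = Complex a b" by (simp only: a_def b_def complex_surj)
  have "a\<^sup>2 + b\<^sup>2 = (cmod (u * x))\<^sup>2" by (simp add: a_def b_def cmod_power2)
  also have "\<dots> \<le> 1" using assms u(1) by (simp add: norm_mult power_le_one)
  finally have ab: "a\<^sup>2 + b\<^sup>2 \<le> 1" .
  define h where "h = sqrt (1 - a\<^sup>2)"
  have a1: "0 \<le> 1 - a\<^sup>2" using ab zero_le_power2[of b] by linarith
  have h: "0 \<le> h" "h\<^sup>2 = 1 - a\<^sup>2" using a1 by (simp_all add: h_def)
  have "b\<^sup>2 \<le> h\<^sup>2" using ab h by simp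
  then have bh: "\<bar>b\<bar> \<le> h" using h(1) by (simp add: abs_le_square_iff[symmetric])
  \<comment> \<open>If \<open>h = 0\<close> then also \<open>b = 0\<close> and both ends coincide;
    the convention \<open>b / 0 = 0\<close> yields the harmless value t = 1/2.\<close>
  define t where "t = (b / h + 1) / 2"
  have t: "0 \<le> t" "t \<le> 1" "b = (2 * t - 1) * h"
    using bh h(1) by (cases "h = 0"; auto simp: t_def field_simps abs_le_iff)+
  have cancel: "u * (cnj u * w) = w" for w using uu by (simp add: mult.assoc[symmetric])
  have norm: "cmod (cnj u * Complex a h) = 1" "cmod (cnj u * Complex a (- h)) = 1"
    using h(2) by (simp_all only: norm_mult complex_mod_cnj u(1)) (simp_all add: cmod_def)
  have "u * x = u * (of_real t * (cnj u * Complex a h) + of_real (1 - t) * (cnj u * Complex a (- h)))"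
  proof -
    have "u * (of_real t * (cnj u * Complex a h) + of_real (1 - t) * (cnj u * Complex a (- h)))
       = of_real t * (u * (cnj u * Complex a h)) + of_real (1 - t) * (u * (cnj u * Complex a (- h)))"
      by (simp add: algebra_simps)
    also have "\<dots> = Complex a b"
      unfolding cancel t(3) by (simp add: complex_eq_iff algebra_simps)
    finally show ?thesis by (simp only: ux)
  qed
  moreover have "u \<noteq> 0" using u(1) by auto
  ultimately have x: "x = of_real t * (cnj u * Complex a h) + of_real (1 - t) * (cnj u * Complex a (- h))"
    by (simp only: mult_cancel_left simp_thms)
  have re: "Re (\<gamma> * w) = cmod \<gamma> * Re (u * w)" for w
    by (subst u(2)) (simp add: algebra_simps)
  show ?thesis
    by (rule that[OF t(1,2) norm x]) (simp_all only: re cancel ux complex.sel)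
qed

text \<open>
  \<open>correlation_mixture x y z\<close>: the matrix with unit diagonal and entries \<open>x, y, z\<close> at the positions
  \<open>(0, 1)\<close>, \<open>(0, 2)\<close>, \<open>(1, 2)\<close> is a mixture of matrices \<open>|v><v|\<close> with \<open>v = (1, cnj \<phi>, cnj \<chi>)\<close> a vector
  of phases.
\<close>

inductive correlation_mixture :: "complex \<Rightarrow> complex \<Rightarrow> complex \<Rightarrow> bool" where
  phases: "cmod \<phi> = 1 \<Longrightarrow> cmod \<chi> = 1 \<Longrightarrow> correlation_mixture \<phi> \<chi> (cnj \<phi> * \<chi>)"
| mixture: "correlation_mixture x y z \<Longrightarrow> correlation_mixture x' y' z' \<Longrightarrow> 0 \<le> t \<Longrightarrow> t \<le> 1 \<Longrightarrow>
    correlation_mixture (of_real t * x + of_real (1 - t) * x')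
      (of_real t * y + of_real (1 - t) * y') (of_real t * z + of_real (1 - t) * z')"

lemma convex_same: "of_real t * x + of_real (1 - t) * x = (x :: complex)"
  by (simp add: algebra_simps)

text \<open>With one of the two entries a phase, that entry is kept fixed and the other is split
  into two phases; \<open>cnj x * y\<close> is affine in the entry being split, up to
  conjugation.\<close>

lemma correlation_mixture_unimodular:
  assumes "cmod x \<le> 1" "cmod y \<le> 1" "cmod x = 1 \<or> cmod y = 1"
  shows "correlation_mixture x y (cnj x * y)"
  using assms(3)
proof
  assume x: "cmod x = 1"
  obtain t \<phi> \<phi>' where c: "0 \<le> t" "t \<le> 1" "cmod \<phi> = 1" "cmod \<phi>' = 1"
    "y = of_real t * \<phi> + of_real (1 - t) * \<phi>'"
    using unit_disc_chord[OF assms(2)] by metis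
  have "correlation_mixture (of_real t * x + of_real (1 - t) * x)
      (of_real t * \<phi> + of_real (1 - t) * \<phi>') (of_real t * (cnj x * \<phi>) + of_real (1 - t) * (cnj x * \<phi>'))"
    using c x by (intro correlation_mixture.intros)
  then show ?thesis unfolding convex_same c(5) by (simp add: algebra_simps)
next
  assume y: "cmod y = 1"
  obtain t \<phi> \<phi>' where c: "0 \<le> t" "t \<le> 1" "cmod \<phi> = 1" "cmod \<phi>' = 1"
    "x = of_real t * \<phi> + of_real (1 - t) * \<phi>'"
    using unit_disc_chord[OF assms(1)] by metis
  have "correlation_mixture (of_real t * \<phi> + of_real (1 - t) * \<phi>')
      (of_real t * y + of_real (1 - t) * y) (of_real t * (cnj \<phi> * y) + of_real (1 - t) * (cnj \<phi>' * y))"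
    using c y by (intro correlation_mixture.intros)
  then show ?thesis unfolding convex_same c(5) by (simp add: algebra_simps)
qed

lemma cmod_add_power2: "(cmod (a + b))\<^sup>2 = (cmod a)\<^sup>2 + (cmod b)\<^sup>2 + 2 * Re (cnj a * b)"
  unfolding cmod_power2 by (simp add: power2_eq_square algebra_simps)

text \<open>
  If the determinant vanishes, the last column is \<open>\<alpha>\<close> times the first plus \<open>\<beta>\<close> times the second. A vector
  \<open>(1, cnj \<phi>, cnj (\<alpha> + \<beta> \<phi>))\<close> in the range consists of phases iff \<open>\<phi>\<close> is a phase and \<open>\<bar>\<alpha> + \<beta> \<phi>\<bar> = 1\<close>, a
  condition on \<open>Re (cnj \<alpha> * \<beta> * \<phi>)\<close> which \<open>x\<close> itself satisfies. So it suffices to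
  cut the unit disc along the chord through \<open>x\<close> on which this real part is constant.
\<close>

lemma correlation_mixture_singular:
  assumes x: "cmod x < 1" and y: "cmod y \<le> 1"
    and det: "(cmod (z - cnj x * y))\<^sup>2 = (1 - (cmod x)\<^sup>2) * (1 - (cmod y)\<^sup>2)"
  shows "correlation_mixture x y z"
proof -
  define D where "D = 1 - (cmod x)\<^sup>2"
  have D: "0 < D" using x by (simp add: D_def abs_square_less_1)
  \<comment> \<open>Cramer's rule for y = \<alpha> + \<beta> x and z = \<alpha> cnj x + \<beta>, a
    system with determinant D.\<close>
  define \<beta> where "\<beta> = (z - cnj x * y) / of_real D"
  define \<alpha> where "\<alpha> = y - \<beta> * x"
  have y_eq: "y = \<alpha> + \<beta> * x" by (simp add: \<alpha>_def)
  have xx: "x * cnj x = 1 - of_real D" by (simp add: D_def mult_cnj_cmod)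
  have bD: "\<beta> * of_real D = z - cnj x * y" using D by (simp add: \<beta>_def)
  have "\<alpha> * cnj x + \<beta> = y * cnj x + \<beta> * (1 - x * cnj x)" by (simp add: \<alpha>_def algebra_simps)
  also have "\<dots> = z" by (simp add: xx bD)
  finally have z_eq: "z = \<alpha> * cnj x + \<beta>" by simp
  have "(cmod \<beta>)\<^sup>2 * D\<^sup>2 = D * (1 - (cmod y)\<^sup>2)"
    using arg_cong[OF bD, of "\<lambda>w. (cmod w)\<^sup>2"] det by (simp add: norm_mult power_mult_distrib D_def[symmetric])
  then have b2: "(cmod \<beta>)\<^sup>2 * D = 1 - (cmod y)\<^sup>2" using D by (simp add: power2_eq_square)
  have "(cmod y)\<^sup>2 = (cmod \<alpha>)\<^sup>2 + (cmod \<beta>)\<^sup>2 * (cmod x)\<^sup>2 + 2 * Re (cnj \<alpha> * \<beta> * x)"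
    unfolding y_eq cmod_add_power2 by (simp add: norm_mult power_mult_distrib mult.assoc)
  \<comment> \<open>By \<open>b2\<close>, |\<beta>|^2 |x|^2 + 1 - |y|^2 = |\<beta>|^2. Hence x,
    though inside the disc, satisfies the equation that a phase \<phi> with |\<alpha> + \<beta>
    \<phi>| = 1 would satisfy.\<close>
  then have one: "(cmod \<alpha>)\<^sup>2 + (cmod \<beta>)\<^sup>2 + 2 * Re (cnj \<alpha> * \<beta> * x) = 1"
    using b2 unfolding D_def by (simp add: algebra_simps)
  have unit: "cmod (\<alpha> + \<beta> * \<phi>) = 1" if "cmod \<phi> = 1" "Re (cnj \<alpha> * \<beta> * \<phi>) = Re (cnj \<alpha> * \<beta> * x)" for \<phi>
  proof -
    have "(cmod (\<alpha> + \<beta> * \<phi>))\<^sup>2 = (cmod \<alpha>)\<^sup>2 + (cmod \<beta>)\<^sup>2 + 2 * Re (cnj \<alpha> * \<beta> * \<phi>)"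
      unfolding cmod_add_power2 using that by (simp add: norm_mult mult.assoc)
    also have "\<dots> = 1\<^sup>2" using one unfolding that(2) by simp
    finally show ?thesis by (rule power2_eq_imp_eq) simp_all
  qed
  obtain t \<phi> \<phi>' where c: "0 \<le> t" "t \<le> 1" "cmod \<phi> = 1" "cmod \<phi>' = 1"
    "x = of_real t * \<phi> + of_real (1 - t) * \<phi>'"
    "Re (cnj \<alpha> * \<beta> * \<phi>) = Re (cnj \<alpha> * \<beta> * x)" "Re (cnj \<alpha> * \<beta> * \<phi>') = Re (cnj \<alpha> * \<beta> * x)"
    using unit_disc_chord[of x "cnj \<alpha> * \<beta>"] x by (metis less_imp_le)
  have "correlation_mixture (of_real t * \<phi> + of_real (1 - t) * \<phi>')
      (of_real t * (\<alpha> + \<beta> * \<phi>) + of_real (1 - t) * (\<alpha> + \<beta> * \<phi>'))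
      (of_real t * (cnj \<phi> * (\<alpha> + \<beta> * \<phi>)) + of_real (1 - t) * (cnj \<phi>' * (\<alpha> + \<beta> * \<phi>')))"
    using c unit by (intro correlation_mixture.intros) auto
  moreover have "of_real t * (\<alpha> + \<beta> * \<phi>) + of_real (1 - t) * (\<alpha> + \<beta> * \<phi>') = y"
    unfolding y_eq c(5) by (simp add: algebra_simps)
  \<comment> \<open>On the unit circle the third entry is affine in \<open>cnj w\<close>, so mixing
    the two ends of the chord reproduces z.\<close>
  moreover have "cnj w * (\<alpha> + \<beta> * w) = \<alpha> * cnj w + \<beta>" if "cmod w = 1" for w
    using that mult_cnj_cmod[of w] by (simp add: algebra_simps)
  moreover have "of_real t * (\<alpha> * cnj \<phi> + \<beta>) + of_real (1 - t) * (\<alpha> * cnj \<phi>' + \<beta>) = z"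
    unfolding z_eq c(5) by (simp add: algebra_simps)
  ultimately show ?thesis using c by simp
qed

text \<open>The determinant of the correlation matrix is (1 - |x|^2) (1 - |y|^2) - |z - cnj x *
  y|^2. For fixed x and y the admissible z form a disc, and each of its points is a mixture of two
  boundary points, where the determinant vanishes.\<close>

lemma correlation_mixtureI:
  assumes x: "cmod x \<le> 1" and y: "cmod y \<le> 1"
    and det: "(cmod (z - cnj x * y))\<^sup>2 \<le> (1 - (cmod x)\<^sup>2) * (1 - (cmod y)\<^sup>2)"
  shows "correlation_mixture x y z"
proof (cases "cmod x = 1 \<or> cmod y = 1")
  case True
  then have "(1 - (cmod x)\<^sup>2) * (1 - (cmod y)\<^sup>2) = 0" by auto
  then have "z = cnj x * y" using det by (simp del: mult_eq_0_iff)
  then show ?thesis using correlation_mixture_unimodular[OF x y True] by simp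
next
  case False
  then have lt: "cmod x < 1" "cmod y < 1" using x y by auto
  define r where "r = sqrt ((1 - (cmod x)\<^sup>2) * (1 - (cmod y)\<^sup>2))"
  have pos: "0 < (1 - (cmod x)\<^sup>2) * (1 - (cmod y)\<^sup>2)"
    using lt by (simp add: abs_square_less_1)
  then have r: "0 < r" "r\<^sup>2 = (1 - (cmod x)\<^sup>2) * (1 - (cmod y)\<^sup>2)"
    by (simp_all add: r_def)
  have "(cmod (z - cnj x * y))\<^sup>2 \<le> r\<^sup>2" using det by (simp only: r(2))
  then have "cmod (z - cnj x * y) \<le> r" by (rule power2_le_imp_le) (use r(1) in simp)
  then have "cmod ((z - cnj x * y) / of_real r) \<le> 1" using r(1) by (simp add: norm_divide)
  then obtain t \<phi> \<phi>' where c: "0 \<le> t" "t \<le> 1" "cmod \<phi> = 1" "cmod \<phi>' = 1"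
    "(z - cnj x * y) / of_real r = of_real t * \<phi> + of_real (1 - t) * \<phi>'"
    using unit_disc_chord by metis
  have "correlation_mixture x y (cnj x * y + of_real r * w)" if "cmod w = 1" for w
  proof (rule correlation_mixture_singular)
    have "(cmod (of_real r * w))\<^sup>2 = r\<^sup>2" using that by (simp add: norm_mult power_mult_distrib)
    then show "(cmod (cnj x * y + of_real r * w - cnj x * y))\<^sup>2 = (1 - (cmod x)\<^sup>2) * (1 - (cmod y)\<^sup>2)"
      by (simp only: add_diff_cancel_left' r(2))
  qed (use lt in auto)
  then have "correlation_mixture (of_real t * x + of_real (1 - t) * x) (of_real t * y + of_real (1 - t) * y)
      (of_real t * (cnj x * y + of_real r * \<phi>) + of_real (1 - t) * (cnj x * y + of_real r * \<phi>'))"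
    using c by (intro correlation_mixture.mixture) auto
  moreover have "of_real t * (cnj x * y + of_real r * \<phi>) + of_real (1 - t) * (cnj x * y + of_real r * \<phi>')
      = cnj x * y + of_real r * (of_real t * \<phi> + of_real (1 - t) * \<phi>')"
    by (simp add: algebra_simps)
  moreover have "\<dots> = z" unfolding c(5)[symmetric] using r(1) by simp
  ultimately show ?thesis by (simp only: convex_same)
qed

text \<open>Flattens nested mixtures into one finite weighted family; with lists, mixing is
  rescaling followed by concatenation.\<close>

lemma correlation_mixture_list:
  assumes "correlation_mixture x y z"
  shows "\<exists>xs :: (real \<times> complex \<times> complex) list.
    (\<forall>(w, \<phi>, \<chi>)\<in>set xs. 0 \<le> w \<and> cmod \<phi> = 1 \<and> cmod \<chi> = 1) \<and>
    (\<Sum>(w, \<phi>, \<chi>)\<leftarrow>xs. of_real w) = (1 :: complex) \<and> (\<Sum>(w, \<phi>, \<chi>)\<leftarrow>xs. of_real w * \<phi>) = x \<and>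
    (\<Sum>(w, \<phi>, \<chi>)\<leftarrow>xs. of_real w * \<chi>) = y \<and> (\<Sum>(w, \<phi>, \<chi>)\<leftarrow>xs. of_real w * (cnj \<phi> * \<chi>)) = z"
  using assms
proof induction
  case (phases \<phi> \<chi>)
  then show ?case by (intro exI[of _ "[(1, \<phi>, \<chi>)]"]) simp
next
  case (mixture x y z x' y' z' t)
  obtain xs where xs: "\<forall>(w, \<phi>, \<chi>)\<in>set xs. 0 \<le> w \<and> cmod \<phi> = 1 \<and> cmod \<chi> = 1"
    "(\<Sum>(w, \<phi>, \<chi>)\<leftarrow>xs. of_real w) = (1 :: complex)" "(\<Sum>(w, \<phi>, \<chi>)\<leftarrow>xs. of_real w * \<phi>) = x"
    "(\<Sum>(w, \<phi>, \<chi>)\<leftarrow>xs. of_real w * \<chi>) = y" "(\<Sum>(w, \<phi>, \<chi>)\<leftarrow>xs. of_real w * (cnj \<phi> * \<chi>)) = z"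
    using mixture.IH(1) by (elim exE conjE)
  obtain ys where ys: "\<forall>(w, \<phi>, \<chi>)\<in>set ys. 0 \<le> w \<and> cmod \<phi> = 1 \<and> cmod \<chi> = 1"
    "(\<Sum>(w, \<phi>, \<chi>)\<leftarrow>ys. of_real w) = (1 :: complex)" "(\<Sum>(w, \<phi>, \<chi>)\<leftarrow>ys. of_real w * \<phi>) = x'"
    "(\<Sum>(w, \<phi>, \<chi>)\<leftarrow>ys. of_real w * \<chi>) = y'" "(\<Sum>(w, \<phi>, \<chi>)\<leftarrow>ys. of_real w * (cnj \<phi> * \<chi>)) = z'"
    using mixture.IH(2) by (elim exE conjE)
  define scale where "scale s zs = map (\<lambda>(w, \<phi>, \<chi>). (s * w, \<phi>, \<chi>)) zs"
    for s :: real and zs :: "(real \<times> complex \<times> complex) list"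
  have sum_scale: "(\<Sum>(w, \<phi>, \<chi>)\<leftarrow>scale s zs. of_real w * f \<phi> \<chi>) = of_real s * (\<Sum>(w, \<phi>, \<chi>)\<leftarrow>zs. of_real w * f \<phi> \<chi>)"
    for s zs and f :: "complex \<Rightarrow> complex \<Rightarrow> complex"
    by (induction zs) (auto simp: scale_def algebra_simps)
  have set_scale: "\<forall>(w, \<phi>, \<chi>)\<in>set (scale s zs). 0 \<le> w \<and> cmod \<phi> = 1 \<and> cmod \<chi> = 1"
    if "0 \<le> s" "\<forall>(w, \<phi>, \<chi>)\<in>set zs. 0 \<le> w \<and> cmod \<phi> = 1 \<and> cmod \<chi> = 1" for s zs
    using that by (fastforce simp: scale_def)
  define zs where "zs = scale t xs @ scale (1 - t) ys"
  have comb: "(\<Sum>(w, \<phi>, \<chi>)\<leftarrow>zs. of_real w * f \<phi> \<chi>) = of_real t * (\<Sum>(w, \<phi>, \<chi>)\<leftarrow>xs. of_real w * f \<phi> \<chi>)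
      + of_real (1 - t) * (\<Sum>(w, \<phi>, \<chi>)\<leftarrow>ys. of_real w * f \<phi> \<chi>)" for f :: "complex \<Rightarrow> complex \<Rightarrow> complex"
    by (simp only: zs_def map_append sum_list_append sum_scale)
  have "\<forall>(w, \<phi>, \<chi>)\<in>set zs. 0 \<le> w \<and> cmod \<phi> = 1 \<and> cmod \<chi> = 1"
    unfolding zs_def set_append ball_Un
    using set_scale[OF \<open>0 \<le> t\<close> xs(1)] set_scale[OF _ ys(1), of "1 - t"] \<open>t \<le> 1\<close> by simp
  moreover have "(\<Sum>(w, \<phi>, \<chi>)\<leftarrow>zs. of_real w) = (1 :: complex)"
    using comb[of "\<lambda>_ _. 1"] unfolding mult_1_right xs(2) ys(2) by simp
  ultimately show ?case
    using comb[of "\<lambda>\<phi> _. \<phi>"] comb[of "\<lambda>_ \<chi>. \<chi>"] comb[of "\<lambda>\<phi> \<chi>. cnj \<phi> * \<chi>"]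
    unfolding xs(3-5) ys(3-5) by (intro exI[of _ zs] conjI)
qed

section \<open>Density matrices in dimension at most three\<close>

lemma positive_form_2:
  fixes A B :: real and G :: complex
  assumes form: "\<And>c d. 0 \<le> A * (cmod c)\<^sup>2 + B * (cmod d)\<^sup>2 + 2 * Re (cnj c * d * G)"
  shows "0 \<le> A" "0 \<le> B" "(cmod G)\<^sup>2 \<le> A * B"
proof -
  show A: "0 \<le> A" and B: "0 \<le> B"
    using form[of 1 0] form[of 0 1] by simp_all
  show "(cmod G)\<^sup>2 \<le> A * B"
  proof (cases "A = 0")
    case True
    show ?thesis
    proof (rule ccontr)
      assume "\<not> ?thesis"
      then have G: "0 < (cmod G)\<^sup>2" using True by simp
      \<comment> \<open>Chosen so that the form takes the value -1 at the test vector.\<close>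
      define s where "s = (B + 1) / (2 * (cmod G)\<^sup>2)"
      have "Re (cnj (of_real (- s) * G) * 1 * G) = - s * (cmod G)\<^sup>2"
        unfolding cmod_power2 by (simp add: power2_eq_square algebra_simps)
      then have "0 \<le> B - 2 * s * (cmod G)\<^sup>2"
        using form[of "of_real (- s) * G" 1] True by simp
      also have "\<dots> = B - s * (2 * (cmod G)\<^sup>2)" by simp
      also have "s * (2 * (cmod G)\<^sup>2) = B + 1" using G by (simp add: s_def)
      finally show False by simp
    qed
  next
    case False
    then have A0: "0 < A" using A by simp
    \<comment> \<open>For d = A the form is minimal at c = - G, where its value is A times the
      determinant.\<close>
    have "Re (cnj (- G) * of_real A * G) = - A * (cmod G)\<^sup>2"
      unfolding cmod_power2 by (simp add: power2_eq_square algebra_simps)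
    then have "0 \<le> A * (cmod G)\<^sup>2 + B * A\<^sup>2 - 2 * A * (cmod G)\<^sup>2"
      using form[of "- G" "of_real A"] A by simp
    also have "\<dots> = A * (A * B - (cmod G)\<^sup>2)" by (simp add: power2_eq_square algebra_simps)
    finally show ?thesis using A0 by (simp add: zero_le_mult_iff)
  qed
qed

text \<open>The last conclusion is positivity of the Schur complement of \<open>p0\<close>,
  multiplied by \<open>p0\<close> to avoid quotients.\<close>

lemma positive_form_3:
  fixes p0 p1 p2 :: real and x y z :: complex
  assumes form: "\<And>a b c. 0 \<le> p0 * (cmod a)\<^sup>2 + p1 * (cmod b)\<^sup>2 + p2 * (cmod c)\<^sup>2
      + 2 * Re (cnj a * b * x) + 2 * Re (cnj a * c * y) + 2 * Re (cnj b * c * z)"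
  shows "0 \<le> p0" "0 \<le> p1" "0 \<le> p2"
    "(cmod x)\<^sup>2 \<le> p0 * p1" "(cmod y)\<^sup>2 \<le> p0 * p2" "(cmod z)\<^sup>2 \<le> p1 * p2"
    "0 < p0 \<Longrightarrow> (cmod (of_real p0 * z - cnj x * y))\<^sup>2
      \<le> (p0 * p1 - (cmod x)\<^sup>2) * (p0 * p2 - (cmod y)\<^sup>2)"
proof -
  have xy: "0 \<le> p0 * (cmod a)\<^sup>2 + p1 * (cmod b)\<^sup>2 + 2 * Re (cnj a * b * x)" for a b
    using form[of a b 0] by simp
  have xz: "0 \<le> p0 * (cmod a)\<^sup>2 + p2 * (cmod c)\<^sup>2 + 2 * Re (cnj a * c * y)" for a c
    using form[of a 0 c] by simp
  have yz: "0 \<le> p1 * (cmod b)\<^sup>2 + p2 * (cmod c)\<^sup>2 + 2 * Re (cnj b * c * z)" for b c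
    using form[of 0 b c] by simp
  show "0 \<le> p0" "0 \<le> p1" "(cmod x)\<^sup>2 \<le> p0 * p1" by (rule positive_form_2[OF xy])+
  show "0 \<le> p2" "(cmod y)\<^sup>2 \<le> p0 * p2" by (rule positive_form_2[OF xz])+
  show "(cmod z)\<^sup>2 \<le> p1 * p2" by (rule positive_form_2[OF yz])
  assume p0: "0 < p0"
  have "0 \<le> (p0 * p1 - (cmod x)\<^sup>2) * (cmod b)\<^sup>2 + (p0 * p2 - (cmod y)\<^sup>2) * (cmod c)\<^sup>2
      + 2 * Re (cnj b * c * (of_real p0 * z - cnj x * y))" for b c
  proof -
    define s where "s = b * x + c * y"
    \<comment> \<open>The minimiser of the form in a for fixed b and c; what remains is the Schur
      complement as a form in b and c.\<close>
    define a where "a = - s / of_real p0"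
    have 1: "p0 * (p0 * (cmod a)\<^sup>2) = (cmod s)\<^sup>2"
      using p0 by (simp add: a_def norm_divide power_divide power2_eq_square)
    have "p0 * Re (cnj a * s) = Re (cnj (of_real p0 * a) * s)" by (simp add: algebra_simps)
    also have "of_real p0 * a = - s" using p0 by (simp add: a_def)
    also have "Re (cnj (- s) * s) = - (cmod s)\<^sup>2"
      unfolding cmod_power2 by (simp add: power2_eq_square)
    finally have 2: "p0 * (2 * Re (cnj a * b * x) + 2 * Re (cnj a * c * y)) = - 2 * (cmod s)\<^sup>2"
      by (simp add: s_def algebra_simps)
    have 3: "(cmod s)\<^sup>2 = (cmod b)\<^sup>2 * (cmod x)\<^sup>2 + (cmod c)\<^sup>2 * (cmod y)\<^sup>2 + 2 * Re (cnj b * c * (cnj x * y))"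
      unfolding s_def cmod_add_power2 by (simp only: norm_mult power_mult_distrib complex_cnj_mult mult_ac)
    have 4: "Re (cnj b * c * (of_real p0 * z - cnj x * y)) = p0 * Re (cnj b * c * z) - Re (cnj b * c * (cnj x * y))"
      by (simp add: algebra_simps)
    have "0 \<le> p0 * (p0 * (cmod a)\<^sup>2 + p1 * (cmod b)\<^sup>2 + p2 * (cmod c)\<^sup>2
      + 2 * Re (cnj a * b * x) + 2 * Re (cnj a * c * y) + 2 * Re (cnj b * c * z))"
      using form[of a b c] p0 by simp
    also have "\<dots> = p0 * (p0 * (cmod a)\<^sup>2) + p0 * (2 * Re (cnj a * b * x) + 2 * Re (cnj a * c * y))
        + p0 * p1 * (cmod b)\<^sup>2 + p0 * p2 * (cmod c)\<^sup>2 + 2 * (p0 * Re (cnj b * c * z))"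
      by (simp only: distrib_left mult_ac add_ac)
    finally show ?thesis
      unfolding 1 2 3 4 by (simp only: left_diff_distrib right_diff_distrib distrib_left mult_ac)
  qed
  then show "(cmod (of_real p0 * z - cnj x * y))\<^sup>2 \<le> (p0 * p1 - (cmod x)\<^sup>2) * (p0 * p2 - (cmod y)\<^sup>2)"
    by (rule positive_form_2)
qed

text \<open>If a diagonal entry vanishes, the corresponding quotients are \<open>0 / 0 = 0\<close>, which is what is needed.\<close>

lemma normalised_correlation_mixture:
  fixes p0 p1 p2 :: real and x y z :: complex
  assumes "\<And>a b c. 0 \<le> p0 * (cmod a)\<^sup>2 + p1 * (cmod b)\<^sup>2 + p2 * (cmod c)\<^sup>2
      + 2 * Re (cnj a * b * x) + 2 * Re (cnj a * c * y) + 2 * Re (cnj b * c * z)"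
  shows "correlation_mixture (x / of_real (sqrt (p0 * p1))) (y / of_real (sqrt (p0 * p2)))
    (z / of_real (sqrt (p1 * p2)))"
proof -
  note pos = positive_form_3[OF assms]
  have le1: "cmod (v / of_real (sqrt q)) \<le> 1" and sq: "(cmod (v / of_real (sqrt q)))\<^sup>2 = (cmod v)\<^sup>2 / q"
    if "(cmod v)\<^sup>2 \<le> q" for v :: complex and q
  proof -
    have q: "0 \<le> q" using that zero_le_power2 order_trans by blast
    then show sq: "(cmod (v / of_real (sqrt q)))\<^sup>2 = (cmod v)\<^sup>2 / q"
      by (simp add: norm_divide power_divide)
    have "(cmod v)\<^sup>2 / q \<le> 1" using that q by (cases "q = 0") auto
    then have "(cmod (v / of_real (sqrt q)))\<^sup>2 \<le> 1\<^sup>2" using sq by simp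
    then show "cmod (v / of_real (sqrt q)) \<le> 1" by (rule power2_le_imp_le) simp
  qed
  show ?thesis
  proof (rule correlation_mixtureI)
    show "cmod (x / of_real (sqrt (p0 * p1))) \<le> 1" "cmod (y / of_real (sqrt (p0 * p2))) \<le> 1"
      by (rule le1 pos(4,5))+
    show "(cmod (z / of_real (sqrt (p1 * p2)) - cnj (x / of_real (sqrt (p0 * p1))) * (y / of_real (sqrt (p0 * p2)))))\<^sup>2
      \<le> (1 - (cmod (x / of_real (sqrt (p0 * p1))))\<^sup>2) * (1 - (cmod (y / of_real (sqrt (p0 * p2))))\<^sup>2)"
    proof (cases "p0 = 0 \<or> p1 = 0 \<or> p2 = 0")
      case True
      \<comment> \<open>Each zero diagonal entry makes two of the three quotients vanish, and the
        inequality reduces to the remaining one having modulus at most 1.\<close>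
      then consider "p0 = 0" | "p1 = 0" | "p2 = 0" by blast
      then show ?thesis
      proof cases
        case 1
        then show ?thesis using le1[OF pos(6)] by (simp add: power_le_one)
      next
        case 2
        then show ?thesis using le1[OF pos(5)] by (simp add: power_le_one)
      next
        case 3
        then show ?thesis using le1[OF pos(4)] by (simp add: power_le_one)
      qed
    next
      case False
      then have p: "0 < p0" "0 < p1" "0 < p2" using pos(1-3) by auto
      \<comment> \<open>Common denominator: dividing the unnormalised determinant inequality by
        \<open>s^2\<close> gives the normalised one.\<close>
      define s where "s = sqrt p0 * sqrt p1 * (sqrt p0 * sqrt p2)"
      have s: "s = p0 * sqrt (p1 * p2)" "s \<noteq> 0" "s\<^sup>2 = (p0 * p1) * (p0 * p2)"
        using p by (simp_all add: s_def real_sqrt_mult power_mult_distrib mult_ac)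
      have "z / of_real (sqrt (p1 * p2)) - cnj (x / of_real (sqrt (p0 * p1))) * (y / of_real (sqrt (p0 * p2)))
          = of_real p0 * z / of_real s - cnj x * y / of_real s"
        using p by (simp add: s(1)) (simp add: real_sqrt_mult field_simps flip: of_real_mult)
      also have "\<dots> = (of_real p0 * z - cnj x * y) / of_real s" by (simp add: diff_divide_distrib)
      also have "(cmod \<dots>)\<^sup>2 = (cmod (of_real p0 * z - cnj x * y))\<^sup>2 / s\<^sup>2"
        by (simp add: norm_divide power_divide)
      also have "\<dots> \<le> (p0 * p1 - (cmod x)\<^sup>2) * (p0 * p2 - (cmod y)\<^sup>2) / s\<^sup>2"
        using pos(7)[OF p(1)] by (intro divide_right_mono) auto
      also have "\<dots> = (1 - (cmod x)\<^sup>2 / (p0 * p1)) * (1 - (cmod y)\<^sup>2 / (p0 * p2))"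
        unfolding s(3) using p by (simp add: diff_divide_distrib[symmetric] divide_simps)
      finally show ?thesis unfolding sq[OF pos(4)] sq[OF pos(5)] .
    qed
  qed
qed

section \<open>Density matrices as Hermitian forms, and their uniform decompositions\<close>

lemma density_matrix_form:
  assumes "density_matrix d \<rho>"
  shows "0 \<le> (\<Sum>i<d. \<Sum>j<d. cnj (c i) * \<rho> $$ (i, j) * c j)"
proof -
  have r: "\<rho> \<in> carrier_mat d d" using assms by (simp add: density_matrix_def)
  have eq: "(\<rho> *\<^sub>v vec d c) \<bullet>c vec d c = (\<Sum>i<d. \<Sum>j<d. cnj (c i) * \<rho> $$ (i, j) * c j)"
    using r by (simp add: scalar_prod_def atLeast0LessThan sum_distrib_left sum_distrib_right mult_ac)
  have "0 \<le> (\<rho> *\<^sub>v vec d c) \<bullet>c vec d c" using assms by (simp add: density_matrix_def)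
  then show ?thesis by (simp only: eq)
qed

lemma density_matrix_hermitian:
  assumes "density_matrix d \<rho>" "i < d" "j < d"
  shows "\<rho> $$ (j, i) = cnj (\<rho> $$ (i, j))"
proof -
  \<comment> \<open>Polarisation: the form at e_a + u e_b is real, and u = 1 and u = i compare the
    imaginary and real parts of the two off-diagonal entries.\<close>
  have two: "Im (\<rho> $$ (a, a) + u * \<rho> $$ (a, b) + cnj u * \<rho> $$ (b, a) + cnj u * u * \<rho> $$ (b, b)) = 0"
    if "a < d" "b < d" "a \<noteq> b" for a b u
  proof -
    define c where "c k = (if k = a then 1 else if k = b then u else 0)" for k
    have "(\<Sum>i<d. \<Sum>j<d. cnj (c i) * \<rho> $$ (i, j) * c j) = (\<Sum>i<d. \<Sum>j\<in>{a, b}. cnj (c i) * \<rho> $$ (i, j) * c j)"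
      using that by (intro sum.cong refl sum.mono_neutral_right) (auto simp: c_def)
    also have "\<dots> = (\<Sum>i\<in>{a, b}. \<Sum>j\<in>{a, b}. cnj (c i) * \<rho> $$ (i, j) * c j)"
      using that by (intro sum.mono_neutral_right) (auto simp: c_def)
    also have "\<dots> = \<rho> $$ (a, a) + u * \<rho> $$ (a, b) + cnj u * \<rho> $$ (b, a) + cnj u * u * \<rho> $$ (b, b)"
      using that by (simp add: c_def algebra_simps)
    finally show ?thesis
      using density_matrix_form[OF assms(1), of c] by (simp add: less_eq_complex_def)
  qed
  have diag: "Im (\<rho> $$ (a, a)) = 0" if "a < d" for a
  proof -
    have "(\<Sum>i<d. \<Sum>j<d. cnj (if i = a then 1 else 0) * \<rho> $$ (i, j) * (if j = a then 1 else 0))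
        = (\<Sum>i<d. \<Sum>j\<in>{a}. cnj (if i = a then 1 else 0) * \<rho> $$ (i, j) * (if j = a then 1 else 0))"
      using that by (intro sum.cong refl sum.mono_neutral_right) auto
    also have "\<dots> = (\<Sum>i\<in>{a}. \<Sum>j\<in>{a}. cnj (if i = a then 1 else 0) * \<rho> $$ (i, j) * (if j = a then 1 else 0))"
      using that by (intro sum.mono_neutral_right) auto
    finally show ?thesis
      using density_matrix_form[OF assms(1), of "\<lambda>k. if k = a then 1 else 0"]
      by (simp add: less_eq_complex_def)
  qed
  show ?thesis
  proof (cases "i = j")
    case True
    then show ?thesis using diag[OF assms(2)] by (simp add: complex_eq_iff)
  next
    case False
    then show ?thesis
      using two[OF assms(2,3) False, of 1] two[OF assms(2,3) False, of \<i>] diag assms(2,3)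
      by (simp add: complex_eq_iff)
  qed
qed

text \<open>The matrix is padded with zeros to size three, so that all d <= 3 are treated at once.
  The members are vectors of phases rescaled by the roots of the diagonal.\<close>

lemma uniform_decomposition:
  assumes rho: "density_matrix d \<rho>" and d: "d \<le> 3"
  shows "\<exists>(K :: nat set) w y. vector_decomposition \<rho> K w y \<and>
    (\<forall>k\<in>K. \<forall>a<d. (cmod (y k a))\<^sup>2 = Re (\<rho> $$ (a, a)))"
proof -
  define M where "M i j = (if i < d \<and> j < d then \<rho> $$ (i, j) else 0)" for i j
  define p where "p i = Re (M i i)" for i
  have herm: "M j i = cnj (M i j)" for i j
    using density_matrix_hermitian[OF rho, of i j] by (cases "i < d"; cases "j < d") (simp_all add: M_def)
  have diag: "M i i = of_real (p i)" for i
    using arg_cong[OF herm[of i i], of Im] by (simp add: p_def complex_eq_iff)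
  have form: "0 \<le> (\<Sum>i<3. \<Sum>j<3. cnj (c i) * M i j * c j)" for c
  proof -
    have "(\<Sum>i<3. \<Sum>j<3. cnj (c i) * M i j * c j) = (\<Sum>i<d. \<Sum>j<3. cnj (c i) * M i j * c j)"
      using d by (intro sum.mono_neutral_right) (auto simp: M_def)
    also have "\<dots> = (\<Sum>i<d. \<Sum>j<d. cnj (c i) * M i j * c j)"
      using d by (intro sum.cong refl sum.mono_neutral_right) (auto simp: M_def)
    also have "\<dots> = (\<Sum>i<d. \<Sum>j<d. cnj (c i) * \<rho> $$ (i, j) * c j)"
      by (intro sum.cong refl) (auto simp: M_def)
    finally show ?thesis using density_matrix_form[OF rho] by simp
  qed
  have psd: "0 \<le> p 0 * (cmod a)\<^sup>2 + p 1 * (cmod b)\<^sup>2 + p 2 * (cmod c)\<^sup>2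
      + 2 * Re (cnj a * b * M 0 1) + 2 * Re (cnj a * c * M 0 2) + 2 * Re (cnj b * c * M 1 2)" for a b c
  proof -
    define v where "v k = (if k = 0 then a else if k = 1 then b else c)" for k :: nat
    have "0 \<le> Re (\<Sum>i<3. \<Sum>j<3. cnj (v i) * M i j * v j)"
      using form[of v] by (simp only: less_eq_complex_def zero_complex.sel)
    also have "(\<Sum>i<3. \<Sum>j<3. cnj (v i) * M i j * v j)
        = cnj a * of_real (p 0) * a + cnj b * of_real (p 1) * b + cnj c * of_real (p 2) * c
        + (cnj a * M 0 1 * b + cnj b * cnj (M 0 1) * a)
        + (cnj a * M 0 2 * c + cnj c * cnj (M 0 2) * a)
        + (cnj b * M 1 2 * c + cnj c * cnj (M 1 2) * b)"
      unfolding diag[symmetric] herm[symmetric] by (simp add: eval_nat_numeral v_def)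
    also have "Re \<dots> = p 0 * (cmod a)\<^sup>2 + p 1 * (cmod b)\<^sup>2 + p 2 * (cmod c)\<^sup>2
      + 2 * Re (cnj a * b * M 0 1) + 2 * Re (cnj a * c * M 0 2) + 2 * Re (cnj b * c * M 1 2)"
      unfolding cmod_power2 by (simp add: power2_eq_square algebra_simps)
    finally show ?thesis .
  qed
  note pos = positive_form_3[OF psd]
  \<comment> \<open>If q * r = 0, the hypothesis forces v = 0, so the convention 0 / 0 = 0 loses
    nothing.\<close>
  have scale: "v = of_real (sqrt q) * of_real (sqrt r) * (v / of_real (sqrt (q * r)))"
    if "(cmod v)\<^sup>2 \<le> q * r" for v :: complex and q r
    using that by (cases "q * r = 0") (auto simp: real_sqrt_mult)
  obtain xs :: "(real \<times> complex \<times> complex) list" where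
    xs: "\<forall>(w, \<phi>, \<chi>)\<in>set xs. 0 \<le> w \<and> cmod \<phi> = 1 \<and> cmod \<chi> = 1"
    "(\<Sum>(w, \<phi>, \<chi>)\<leftarrow>xs. of_real w) = (1 :: complex)"
    "(\<Sum>(w, \<phi>, \<chi>)\<leftarrow>xs. of_real w * \<phi>) = M 0 1 / of_real (sqrt (p 0 * p 1))"
    "(\<Sum>(w, \<phi>, \<chi>)\<leftarrow>xs. of_real w * \<chi>) = M 0 2 / of_real (sqrt (p 0 * p 2))"
    "(\<Sum>(w, \<phi>, \<chi>)\<leftarrow>xs. of_real w * (cnj \<phi> * \<chi>)) = M 1 2 / of_real (sqrt (p 1 * p 2))"
    using correlation_mixture_list[OF normalised_correlation_mixture[OF psd]] by (elim exE conjE)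
  define w where "w k = fst (xs ! k)" for k
  define v where "v k a = (if a = 0 then 1 else if a = 1 then cnj (fst (snd (xs ! k))) else cnj (snd (snd (xs ! k))))"
    for k and a :: nat
  define y where "y k a = of_real (sqrt (p a)) * v k a" for k a
  define C where "C a b = (\<Sum>k<length xs. of_real (w k) * v k a * cnj (v k b))" for a b
  have nth: "(\<Sum>x\<leftarrow>xs. f x) = (\<Sum>k<length xs. f (xs ! k))" for f :: "_ \<Rightarrow> complex"
    by (simp add: sum_list_sum_nth atLeast0LessThan)
  have C_off: "C 0 1 = M 0 1 / of_real (sqrt (p 0 * p 1))" "C 0 2 = M 0 2 / of_real (sqrt (p 0 * p 2))"
    "C 1 2 = M 1 2 / of_real (sqrt (p 1 * p 2))"
    unfolding xs(3,4,5)[symmetric] nth C_def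
    by (auto simp: v_def w_def split_beta mult.assoc intro!: sum.cong)
  have wv: "0 \<le> w k" "cmod (v k a) = 1" if "k < length xs" for k a
    using xs(1) nth_mem[OF that] by (auto simp: w_def v_def split_beta)
  have w1: "(\<Sum>k<length xs. of_real (w k)) = (1 :: complex)"
    using xs(2) unfolding nth by (simp add: w_def split_beta)
  have C_diag: "C a a = 1" for a
    unfolding C_def w1[symmetric] using wv by (intro sum.cong) (auto simp: mult.assoc mult_cnj_cmod)
  have C_herm: "C b a = cnj (C a b)" for a b
    unfolding C_def by (simp add: mult_ac)
  have pn: "0 \<le> p a" if "a < 3" for a
    using that pos(1-3) by (auto simp: eval_nat_numeral less_Suc_eq)
  have MC: "M a b = of_real (sqrt (p a)) * of_real (sqrt (p b)) * C a b" if ab: "a < 3" "b < 3" for a b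
  proof -
    have off: "M a b = of_real (sqrt (p a)) * of_real (sqrt (p b)) * C a b" if "a < b" "b < 3" for a b
    proof -
      have "a = 0 \<and> b = 1 \<or> a = 0 \<and> b = 2 \<or> a = 1 \<and> b = 2" using that by auto
      then show ?thesis
        using scale[OF pos(4)] scale[OF pos(5)] scale[OF pos(6)] by (elim disjE conjE) (simp_all only: C_off)
    qed
    consider "a < b" | "b < a" | "a = b" by linarith
    then show ?thesis
    proof cases
      case 1
      then show ?thesis using off ab by simp
    next
      case 2
      then show ?thesis
        using off[of b a] ab by (simp add: herm[where i = b and j = a] C_herm[where a = b and b = a])
    next
      case 3
      then show ?thesis
        using pn[OF ab(1)] by (simp add: diag C_diag flip: of_real_mult)
    qed
  qed
  have "\<rho> $$ (a, b) = (\<Sum>k<length xs. of_real (w k) * y k a * cnj (y k b))" if "a < d" "b < d" for a b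
  proof -
    have "\<rho> $$ (a, b) = of_real (sqrt (p a)) * of_real (sqrt (p b)) * C a b"
      using MC[of a b] that d by (simp add: M_def)
    also have "\<dots> = (\<Sum>k<length xs. of_real (w k) * y k a * cnj (y k b))"
      unfolding C_def sum_distrib_left by (intro sum.cong) (auto simp: y_def mult_ac)
    finally show ?thesis .
  qed
  moreover have "\<rho> \<in> carrier_mat d d" "mat_trace \<rho> = 1"
    using rho by (simp_all add: density_matrix_def)
  ultimately have "vector_decomposition \<rho> {..<length xs} w y"
    using wv by (simp add: vector_decomposition_def)
  moreover have "\<forall>k\<in>{..<length xs}. \<forall>a<d. (cmod (y k a))\<^sup>2 = Re (\<rho> $$ (a, a))"
  proof (intro ballI allI impI)
    fix k a assume "k \<in> {..<length xs}" "a < d"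
    then show "(cmod (y k a))\<^sup>2 = Re (\<rho> $$ (a, a))"
      using wv pn[of a] d by (simp add: y_def norm_mult) (simp add: p_def M_def)
  qed
  ultimately show ?thesis by blast
qed

text \<open>All members have the diagonal of \<rho>, so each has entropy
  \<open>diagonal_entropy \<rho>\<close> and the upper bound is attained.\<close>

lemma equality_dimension_three:
  assumes rho: "density_matrix d \<rho>" and d: "d \<le> 3"
  shows "coherence_of_assistance \<rho> = regularized_coherence_of_assistance \<rho>"
proof -
  obtain K :: "nat set" and w y where dec: "vector_decomposition \<rho> K w y"
    and y: "\<And>k a. k \<in> K \<Longrightarrow> a < d \<Longrightarrow> (cmod (y k a))\<^sup>2 = Re (\<rho> $$ (a, a))"
    using uniform_decomposition[OF assms] by blast
  have dim: "dim_row \<rho> = d" using rho by (auto simp: density_matrix_def)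
  have "(\<Sum>a<d. Re (\<rho> $$ (a, a))) = Re (mat_trace \<rho>)"
    by (simp add: mat_trace_def dim)
  also have "\<dots> = 1" using rho by (simp add: density_matrix_def)
  finally have tr: "(\<Sum>a<d. Re (\<rho> $$ (a, a))) = 1" .
  have w: "(\<Sum>k\<in>K. w k) = 1"
    using vector_decomposition_total[OF dec] by (simp add: dim y tr)
  have "(\<Sum>k\<in>K. w k * ((\<Sum>a<d. eta ((cmod (y k a))\<^sup>2)) - eta (\<Sum>a<d. (cmod (y k a))\<^sup>2)))
      = (\<Sum>k\<in>K. w k * diagonal_entropy \<rho>)"
    by (intro sum.cong refl) (simp add: y tr diagonal_entropy_def dim)
  also have "\<dots> = diagonal_entropy \<rho>"
    by (simp add: sum_distrib_right[symmetric] w)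
  finally have "diagonal_entropy \<rho> \<le> coherence_of_assistance \<rho>"
    using vector_decomposition_le_coherence[OF dec] by (simp only: dim)
  then have "coherence_of_assistance \<rho> = diagonal_entropy \<rho>"
    using coherence_le_diagonal_entropy[OF dec] by simp
  moreover obtain m p \<psi> where "pure_state_decomposition \<rho> m p \<psi>"
    using vector_imp_pure_state_decomposition[OF dec] by (elim exE conjE)
  ultimately show ?thesis using regularized_coherence by metis
qed

theorem proposition7:
  shows "(\<forall>d \<rho>. d \<le> 3 \<and> density_matrix d \<rho> \<longrightarrow>
            coherence_of_assistance \<rho> = regularized_coherence_of_assistance \<rho>) \<and>
         (\<forall>d\<ge>4. \<exists>\<rho>. density_matrix d \<rho> \<and>
            regularized_coherence_of_assistance \<rho> > coherence_of_assistance \<rho>)"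
  using equality_dimension_three strict_gap_dimension_four by blast

end
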